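(* Let $p$ be an odd prime. For $d\mid p-1$ put $\beta_d=\gcd\!\left(d,\frac{p-1}{2}\right)$ and $g_d=\gcd\!\left(\frac{p-1}{2}+d,\,p-1\right)$. Then $$\Psi^w_{\mathbb{Z}_{4p}}(x)=\frac{1}{2p-2}\sum_{d\mid p-1}\phi\!\left(\frac{p-1}{d}\right)\Big[\Big\{\big(1+x^{\frac{2p-2}{d}}\big)^{d}+\big(1+x^{\frac{2p-2}{g_d}}\big)^{g_d}\Big\}\big(1+x^{\frac{p-1}{\beta_d}}\big)^{2\beta_d}(1+x^2)(1+x)$$ $$-2\big(1+x^{\frac{p-1}{\beta_d}}\big)^{2\beta_d}(1+x)-2(1+x^2)(1+x)+2(1+x)\Big],$$ and hence $$\mathcal{E}^w(\mathbb{Z}_{4p})=\frac{1}{2p-2}\sum_{d\mid p-1}\phi\!\left(\frac{p-1}{d}\right)\Big[4^{\beta_d+1}\big(2^d+2^{g_d}\big)-2^{2\beta_d+2}-4\Big].$$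
   Context: $\phi$ is Euler's totient function. For a finite group $\mathcal{A}$ with identity $e$, let $G(\mathcal{A})=\{\Omega\subseteq\mathcal{A}:\Omega^{-1}=\Omega,\ \langle\Omega\rangle=\mathcal{A},\ e\notin\Omega\}$. $\mathrm{Aut}(\mathcal{A})$ acts on $G(\mathcal{A})$ by $\alpha\cdot\Omega=\alpha(\Omega)$. For $k\ge1$ let $a^w_k(\mathcal{A})$ be the number of orbits of $\mathrm{Aut}(\mathcal{A})$ on $\{\Omega\in G(\mathcal{A}):|\Omega|=k\}$ (the number of weak equivalence classes of Cayley graphs $C(\mathcal{A},\Omega)$ of degree $k$); $\Psi^w_{\mathcal{A}}(x)=\sum_{k=1}^{|\mathcal{A}|-1}a^w_k(\mathcal{A})x^k$ and $\mathcal{E}^w(\mathcal{A})=\Psi^w_{\mathcal{A}}(1)$. For cyclic groups $\mathbb{Z}_n$, $\mathrm{Aut}(\mathbb{Z}_n)$ consists of multiplications by units mod $n$. *)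

theory Defs
  imports "HOL-Number_Theory.Number_Theory"
begin

text \<open>The cyclic group Z_n is modelled as the carrier {0..<n} with addition mod n.\<close>

inductive_set zgen :: "nat \<Rightarrow> nat set \<Rightarrow> nat set" for n :: nat and S :: "nat set" where
  zgen_zero: "0 \<in> zgen n S"
| zgen_base: "x \<in> S \<Longrightarrow> x \<in> zgen n S"
| zgen_add: "a \<in> zgen n S \<Longrightarrow> b \<in> zgen n S \<Longrightarrow> (a + b) mod n \<in> zgen n S"

definition zneg :: "nat \<Rightarrow> nat \<Rightarrow> nat" where
  "zneg n x = (n - x) mod n"

definition Gset :: "nat \<Rightarrow> nat set set" where
  "Gset n = {\<Omega>. \<Omega> \<subseteq> {0..<n} \<and> zneg n ` \<Omega> = \<Omega> \<and> zgen n \<Omega> = {0..<n} \<and> 0 \<notin> \<Omega>}"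

text \<open>Aut(Z_n) = multiplications by units mod n.\<close>
definition zunits :: "nat \<Rightarrow> nat set" where
  "zunits n = {u \<in> {0..<n}. coprime u n}"

definition aut_orbit :: "nat \<Rightarrow> nat set \<Rightarrow> nat set set" where
  "aut_orbit n \<Omega> = {(\<lambda>x. (u * x) mod n) ` \<Omega> | u. u \<in> zunits n}"

definition aw :: "nat \<Rightarrow> nat \<Rightarrow> nat" where
  "aw n k = card (aut_orbit n ` {\<Omega> \<in> Gset n. card \<Omega> = k})"

definition Psi_w :: "nat \<Rightarrow> real \<Rightarrow> real" where
  "Psi_w n x = (\<Sum>k = 1..n - 1. real (aw n k) * x ^ k)"

definition E_w :: "nat \<Rightarrow> real" where
  "E_w n = Psi_w n 1"

end

theory Submission
  imports Defs "HOL-Algebra.Group_Action"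
begin

text \<open>
  By Burnside's lemma, \<open>\<phi>(n) \<Psi>(x)\<close> is the sum over the units \<open>u\<close> of the size enumerator of the
  connection sets fixed by \<open>u\<close>. A subset is both symmetric and fixed by \<open>u\<close> iff it is a union of orbits
  of the monoid generated by \<open>u\<close> and \<open>-1\<close>. All elements of additive order \<open>m\<close> have orbits of the same
  size \<open>s\<close>, so they contribute a factor \<open>(1 + x^s)^(\<phi>(m)/s)\<close>. For \<open>n = 4p\<close>, the non-generating sets are
  those inside one of the two maximal subgroups, of orders \<open>2p\<close> and \<open>4\<close>, and are removed by
  inclusion-exclusion. The orbit sizes are read off from the discrete logarithm \<open>i\<close> of \<open>u\<close> modulo \<open>p\<close>
  after replacing \<open>u\<close> by \<open>-u\<close>, which fixes the same symmetric sets, if \<open>u \<equiv> 3\<close> modulo 4; this shifts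
  \<open>i\<close> by \<open>(p - 1)/2\<close> and produces the terms with \<open>g_d\<close>. Grouping the logarithms by
  \<open>d = gcd(i, p - 1)\<close> gives the formula.
\<close>

section \<open>Generating sets and Burnside counting\<close>

lemma zgen_subset:
  assumes "n > 0" "S \<subseteq> {0..<n}"
  shows "zgen n S \<subseteq> {0..<n}"
proof
  fix x assume "x \<in> zgen n S"
  then show "x \<in> {0..<n}" by induction (use assms in auto)
qed

lemma zgen_mult:
  assumes "a mod n \<in> zgen n S"
  shows "(a * k) mod n \<in> zgen n S"
proof (induction k)
  case (Suc k)
  then show ?case using zgen_add[OF Suc assms] by (simp add: mod_simps add.commute)
qed (simp add: zgen_zero)

lemma zgen_gcd:
  assumes n: "n > 0" and a: "a mod n \<in> zgen n S" and b: "b mod n \<in> zgen n S"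
  shows "gcd a b mod n \<in> zgen n S"
proof (cases "a = 0")
  case False
  then obtain x y where xy: "a * x = b * y + gcd a b" using bezout_nat by blast
  \<comment> \<open>The coefficient \<open>(n - 1) * y\<close> represents \<open>- y\<close> modulo
    \<open>n\<close>, so the Bezout relation is realised by additions alone.\<close>
  have "((a * x) mod n + (b * ((n - 1) * y)) mod n) mod n \<in> zgen n S"
    by (intro zgen_add zgen_mult a b)
  moreover have "a * x + b * ((n - 1) * y) = gcd a b + n * (b * y)"
    using xy n by (cases n) (auto simp: algebra_simps)
  ultimately show ?thesis by (simp add: mod_simps)
qed (use b in simp)

text \<open>The maximal subgroups consist of the multiples of a prime divisor of \<open>n\<close>,
  and a set generates iff none of them contains it. For the converse, the positive generator
  \<open>g\<close> of the closure divides \<open>n\<close> and every element of \<open>S\<close>, so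
  it has no prime factor.\<close>

lemma zgen_eq_iff:
  assumes n: "n > 0" and S: "S \<subseteq> {0..<n}"
  shows "zgen n S = {0..<n} \<longleftrightarrow> (\<forall>q. prime q \<and> q dvd n \<longrightarrow> (\<exists>y\<in>S. \<not> q dvd y))"
proof (intro iffI allI impI)
  fix q assume gen: "zgen n S = {0..<n}" and q: "prime q \<and> q dvd n"
  show "\<exists>y\<in>S. \<not> q dvd y"
  proof (rule ccontr)
    assume "\<not> (\<exists>y\<in>S. \<not> q dvd y)"
    then have all: "q dvd y" if "y \<in> S" for y using that by blast
    have "q dvd y" if "y \<in> zgen n S" for y
      using that by induction (use all q in \<open>auto simp: dvd_mod_iff\<close>)
    moreover have "1 mod n \<in> zgen n S" using gen n by simp
    ultimately have "q dvd 1" using q by (metis dvd_mod_iff)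
    then show False using q by auto
  qed
next
  assume *: "\<forall>q. prime q \<and> q dvd n \<longrightarrow> (\<exists>y\<in>S. \<not> q dvd y)"
  \<comment> \<open>The candidate \<open>k = n\<close> is admissible because
    \<open>n mod n = 0\<close>, so the minimum exists; the same observation later gives
    \<open>g dvd n\<close>.\<close>
  define g where "g = (LEAST k. k > 0 \<and> k mod n \<in> zgen n S)"
  have g: "g > 0 \<and> g mod n \<in> zgen n S"
    unfolding g_def by (rule LeastI[of _ n]) (use n zgen_zero in auto)
  have g_dvd: "g dvd a" if "a mod n \<in> zgen n S" for a
  proof -
    have "gcd g a > 0 \<and> gcd g a mod n \<in> zgen n S" using g that zgen_gcd[OF n] by auto
    then have "g \<le> gcd g a" unfolding g_def by (rule Least_le)
    then show ?thesis using g gcd_le1_nat[of g a] by (metis gcd_dvd2 le_antisym less_numeral_extra(3))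
  qed
  have "g = 1"
  proof (rule ccontr)
    assume "g \<noteq> 1"
    then obtain q where q: "prime q" "q dvd g" using prime_factor_nat by blast
    moreover have "g dvd n" by (rule g_dvd) (simp add: zgen_zero)
    ultimately obtain y where y: "y \<in> S" "\<not> q dvd y" using * dvd_trans by blast
    moreover have "g dvd y" by (rule g_dvd) (use y S zgen_base in auto)
    ultimately show False using q dvd_trans by blast
  qed
  then have "(1 * k) mod n \<in> zgen n S" for k using g by (intro zgen_mult) auto
  then have "k \<in> zgen n S" if "k < n" for k using that by (metis mod_less mult_1)
  then show "zgen n S = {0..<n}" using zgen_subset[OF n S] by auto
qed

section \<open>Dilations by units and connection sets\<close>

definition dilate :: "nat \<Rightarrow> nat \<Rightarrow> nat set \<Rightarrow> nat set" where
  "dilate n u \<Omega> = (\<lambda>x. (u * x) mod n) ` \<Omega>"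

lemma aut_orbit_eq: "aut_orbit n \<Omega> = {dilate n u \<Omega> | u. u \<in> zunits n}"
  by (simp add: aut_orbit_def dilate_def)

lemma dilate_dilate: "dilate n u (dilate n v \<Omega>) = dilate n (u * v mod n) \<Omega>"
  by (auto simp: dilate_def image_image mod_simps mult.assoc)

lemma dilate_mod: "dilate n (u mod n) \<Omega> = dilate n u \<Omega>"
  by (simp add: dilate_def mod_simps)

lemma dilate_one: "\<Omega> \<subseteq> {0..<n} \<Longrightarrow> dilate n 1 \<Omega> = \<Omega>"
  by (force simp: dilate_def)

lemma inj_on_mult_mod:
  fixes n u :: nat
  assumes "coprime u n"
  shows "inj_on (\<lambda>x. (u * x) mod n) {0..<n}"
proof (rule inj_onI)
  fix x y assume "x \<in> {0..<n}" "y \<in> {0..<n}" "u * x mod n = u * y mod n"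
  then have "[u * x = u * y] (mod n)" by (simp add: cong_def)
  then have "[x = y] (mod n)" using assms cong_mult_lcancel_nat by blast
  then show "x = y" using \<open>x \<in> _\<close> \<open>y \<in> _\<close> by (simp add: cong_def)
qed

lemma card_dilate:
  assumes "coprime u n" "\<Omega> \<subseteq> {0..<n}"
  shows "card (dilate n u \<Omega>) = card \<Omega>"
  unfolding dilate_def by (rule card_image) (rule inj_on_subset[OF inj_on_mult_mod assms(2)], rule assms)

text \<open>Inversion thereby becomes a dilation by a unit, so symmetry and invariance under an
  automorphism are conditions of the same kind.\<close>

lemma zneg_eq:
  assumes "x < n"
  shows "zneg n x = ((n - 1) * x) mod n"
proof (cases "x = 0")
  case False
  have "(n - 1) * x = (n - x) + n * (x - 1)"
    using assms False by (cases x; cases n) (auto simp: algebra_simps)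
  then show ?thesis by (simp add: zneg_def)
qed (simp add: zneg_def)

lemma zneg_image:
  assumes "\<Omega> \<subseteq> {0..<n}"
  shows "zneg n ` \<Omega> = dilate n (n - 1) \<Omega>"
  unfolding dilate_def by (rule image_cong) (use assms zneg_eq in auto)

lemma Gset_iff:
  assumes "n > 0"
  shows "\<Omega> \<in> Gset n \<longleftrightarrow> \<Omega> \<subseteq> {1..<n} \<and> dilate n (n - 1) \<Omega> = \<Omega> \<and>
           (\<forall>q. prime q \<and> q dvd n \<longrightarrow> (\<exists>y\<in>\<Omega>. \<not> q dvd y))"
proof -
  have *: "\<Omega> \<subseteq> {0..<n} \<and> 0 \<notin> \<Omega> \<longleftrightarrow> \<Omega> \<subseteq> {1..<n}"
    by (auto simp: subset_iff Suc_le_eq intro!: Nat.gr0I)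
  show ?thesis
  proof (cases "\<Omega> \<subseteq> {0..<n}")
    case True
    then show ?thesis
      unfolding Gset_def mem_Collect_eq zgen_eq_iff[OF assms True] zneg_image[OF True] *[symmetric]
      by blast
  qed (use * in \<open>auto simp: Gset_def\<close>)
qed

text \<open>Dilations commute, which preserves symmetry, and a unit is divisible by no prime divisor
  of \<open>n\<close>, which preserves generation.\<close>

lemma dilate_Gset:
  assumes u: "coprime u n" and \<Omega>: "\<Omega> \<in> Gset n" and n: "n > 0"
  shows "dilate n u \<Omega> \<in> Gset n"
  unfolding Gset_iff[OF n]
proof (intro conjI allI impI)
  have \<Omega>': "\<Omega> \<subseteq> {1..<n}" "dilate n (n - 1) \<Omega> = \<Omega>"
    "\<And>q. prime q \<and> q dvd n \<Longrightarrow> \<exists>y\<in>\<Omega>. \<not> q dvd y"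
    using \<Omega> by (auto simp: Gset_iff[OF n])
  have "u * x mod n \<noteq> 0" if "x \<in> \<Omega>" for x
  proof
    assume "u * x mod n = 0"
    then have "n dvd x" using u by (metis coprime_commute coprime_dvd_mult_right_iff mod_0_imp_dvd)
    moreover have "0 < x" "x < n" using that \<Omega>'(1) by auto
    ultimately show False by (auto dest: dvd_imp_le)
  qed
  then show "dilate n u \<Omega> \<subseteq> {1..<n}" using n by (force simp: dilate_def)
  have "dilate n (n - 1) (dilate n u \<Omega>) = dilate n u (dilate n (n - 1) \<Omega>)"
    by (simp add: dilate_dilate mult.commute)
  then show "dilate n (n - 1) (dilate n u \<Omega>) = dilate n u \<Omega>"
    unfolding \<Omega>'(2) .
  fix q assume q: "prime q \<and> q dvd n"
  then obtain y where y: "y \<in> \<Omega>" "\<not> q dvd y" using \<Omega>'(3) by blast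
  have "\<not> q dvd u" using q u by (metis coprime_common_divisor not_prime_unit)
  then have "\<not> q dvd u * y mod n" using q y by (simp add: dvd_mod_iff prime_dvd_mult_iff)
  then show "\<exists>y\<in>dilate n u \<Omega>. \<not> q dvd y" using y by (auto simp: dilate_def)
qed

section \<open>The unit group and Burnside's lemma\<close>

definition unit_group :: "nat \<Rightarrow> nat monoid" where
  "unit_group n = \<lparr>carrier = zunits n, mult = (\<lambda>u v. u * v mod n), one = 1\<rparr>"

lemma unit_group_simps [simp]:
  "carrier (unit_group n) = zunits n"
  "mult (unit_group n) = (\<lambda>u v. u * v mod n)"
  "one (unit_group n) = 1"
  by (simp_all add: unit_group_def)

lemma zunits_iff: "u \<in> zunits n \<longleftrightarrow> u < n \<and> coprime u n"
  by (simp add: zunits_def)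

lemma group_unit_group:
  assumes "n > 1"
  shows "group (unit_group n)"
proof (rule groupI)
  fix u assume "u \<in> carrier (unit_group n)"
  then have u: "coprime u n" by (simp add: zunits_iff)
  then obtain v where v: "[u * v = 1] (mod n)" using cong_solve_coprime_nat by auto
  then have "coprime v n" by (metis coprime_1_left coprime_mult_left_iff cong_imp_coprime cong_sym)
  then have "v mod n \<in> zunits n" using assms by (simp add: zunits_iff)
  moreover have "(v mod n) * u mod n = 1" using v assms by (simp add: cong_def mod_simps mult.commute)
  ultimately show "\<exists>v\<in>carrier (unit_group n). v \<otimes>\<^bsub>unit_group n\<^esub> u = \<one>\<^bsub>unit_group n\<^esub>" by auto
qed (use assms in \<open>auto simp: zunits_iff mod_simps mult.assoc\<close>)

lemma card_zunits:
  assumes "n > 1"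
  shows "card (zunits n) = totient n"
proof -
  have "zunits n = totatives n"
    using assms totatives_less[of _ n] by (auto simp: zunits_iff totatives_def intro!: Nat.gr0I)
  then show ?thesis by (simp add: totient_def)
qed

text \<open>The size \<open>k\<close> can be fixed because units act injectively. The maps are
  restricted to the set acted on since \<open>BijGroup\<close> consists of extensional
  bijections.\<close>

lemma group_action_dilate:
  assumes n: "n > 1" 
  shows "group_action (unit_group n) {\<Omega> \<in> Gset n. card \<Omega> = k}
    (\<lambda>u. \<lambda>\<Omega>\<in>{\<Omega> \<in> Gset n. card \<Omega> = k}. dilate n u \<Omega>)"
proof -
  define E where "E = {\<Omega> \<in> Gset n. card \<Omega> = k}"
  define \<phi> where "\<phi> = (\<lambda>u. \<lambda>\<Omega>\<in>E. dilate n u \<Omega>)"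
  interpret group "unit_group n" using n by (rule group_unit_group)
  have sub: "\<Omega> \<subseteq> {0..<n}" if "\<Omega> \<in> E" for \<Omega> using that by (auto simp: E_def Gset_def)
  have closed: "dilate n u \<Omega> \<in> E" if "u \<in> zunits n" "\<Omega> \<in> E" for u \<Omega>
    using that n dilate_Gset card_dilate sub by (auto simp: E_def zunits_iff)
  have bij: "bij_betw (\<phi> u) E E" if u: "u \<in> zunits n" for u
  proof -
    obtain v where v: "v \<in> zunits n" "v * u mod n = 1" "u * v mod n = 1"
      using u Units_inv_Units[of u] l_inv_ex[of u] r_inv_ex[of u] inv_equality
      by (metis unit_group_simps mult.commute)
    show ?thesis
      by (rule bij_betw_byWitness[where f' = "\<phi> v"])
        (use u v closed sub dilate_one in \<open>auto simp: \<phi>_def dilate_dilate\<close>)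
  qed
  have "\<phi> \<in> hom (unit_group n) (BijGroup E)"
  proof (rule homI)
    fix u v assume uv: "u \<in> carrier (unit_group n)" "v \<in> carrier (unit_group n)"
    show "\<phi> (u \<otimes>\<^bsub>unit_group n\<^esub> v) = \<phi> u \<otimes>\<^bsub>BijGroup E\<^esub> \<phi> v"
      using uv closed bij
      by (auto simp: BijGroup_def Bij_def \<phi>_def compose_def fun_eq_iff dilate_dilate)
  qed (use bij in \<open>auto simp: BijGroup_def Bij_def \<phi>_def\<close>)
  then have "group_action (unit_group n) E \<phi>"
    by (simp add: group_action_def group_hom_def group_hom_axioms_def group_BijGroup is_group)
  then show ?thesis by (simp add: E_def \<phi>_def)
qed

lemma finite_Gset: "finite (Gset n)"
  by (rule finite_subset[of _ "Pow {0..<n}"]) (auto simp: Gset_def)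

lemma aw_burnside:
  assumes n: "n > 1"
  shows "aw n k * totient n = (\<Sum>u\<in>zunits n. card {\<Omega> \<in> Gset n. card \<Omega> = k \<and> dilate n u \<Omega> = \<Omega>})"
proof -
  define E where "E = {\<Omega> \<in> Gset n. card \<Omega> = k}"
  define \<phi> where "\<phi> = (\<lambda>u. \<lambda>\<Omega>\<in>E. dilate n u \<Omega>)"
  interpret group_action "unit_group n" E \<phi>
    using group_action_dilate[OF n] by (simp add: E_def \<phi>_def)
  have "aut_orbit n ` E = orbits (unit_group n) E \<phi>"
    by (auto simp: orbits_def orbit_def aut_orbit_eq \<phi>_def)
  moreover have "invariants E \<phi> u = {\<Omega> \<in> Gset n. card \<Omega> = k \<and> dilate n u \<Omega> = \<Omega>}" for u
    by (auto simp: invariants_def E_def \<phi>_def)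
  moreover have "finite E" using finite_Gset by (auto simp: E_def)
  moreover have "finite (zunits n)" by (simp add: zunits_def)
  ultimately show ?thesis
    using burnside n by (simp add: aw_def E_def order_def card_zunits)
qed

lemma Psi_w_burnside:
  assumes n: "n > 1"
  shows "real (totient n) * Psi_w n x =
    (\<Sum>u\<in>zunits n. \<Sum>\<Omega> | \<Omega> \<in> Gset n \<and> dilate n u \<Omega> = \<Omega>. x ^ card \<Omega>)"
proof -
  \<comment> \<open>The range of summation in \<open>Psi_w\<close> loses no set: a connection set
    omits 0, and it is non-empty because \<open>n > 1\<close> has a prime divisor.\<close>
  have card: "card ` Gset n \<subseteq> {1..n - 1}"
  proof
    fix k assume "k \<in> card ` Gset n"
    then obtain \<Omega> where \<Omega>: "\<Omega> \<in> Gset n" "k = card \<Omega>" by blast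
    then have "\<Omega> \<subseteq> {1..<n}" using n by (simp add: Gset_iff)
    moreover obtain q where "prime q" "q dvd n" using n prime_factor_nat[of n] by auto
    then have "\<Omega> \<noteq> {}" using \<Omega> n by (auto simp: Gset_iff)
    ultimately show "k \<in> {1..n - 1}"
      using \<Omega>(2) card_mono[of "{1..<n}" \<Omega>] finite_subset[of \<Omega> "{1..<n}"]
      by (auto simp: Suc_le_eq card_gt_0_iff)
  qed
  have "real (totient n) * Psi_w n x = (\<Sum>k = 1..n - 1. real (aw n k * totient n) * x ^ k)"
    by (simp add: Psi_w_def sum_distrib_left mult_ac)
  also have "\<dots> = (\<Sum>k = 1..n - 1. \<Sum>u\<in>zunits n.
      \<Sum>\<Omega> | \<Omega> \<in> {\<Omega> \<in> Gset n. dilate n u \<Omega> = \<Omega>} \<and> card \<Omega> = k. x ^ card \<Omega>)"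
    by (simp add: aw_burnside[OF n] sum_distrib_right conj_ac)
  also have "\<dots> = (\<Sum>u\<in>zunits n. \<Sum>k = 1..n - 1.
      \<Sum>\<Omega> | \<Omega> \<in> {\<Omega> \<in> Gset n. dilate n u \<Omega> = \<Omega>} \<and> card \<Omega> = k. x ^ card \<Omega>)"
    by (rule sum.swap)
  also have "\<dots> = (\<Sum>u\<in>zunits n. \<Sum>\<Omega> | \<Omega> \<in> Gset n \<and> dilate n u \<Omega> = \<Omega>. x ^ card \<Omega>)"
    by (intro sum.cong refl sum.group) (use card finite_Gset in auto)
  finally show ?thesis .
qed

section \<open>Sets invariant under a monoid of units\<close>

text \<open>Non-empty disjoint blocks can be recovered from their union, so unions correspond
  bijectively to subfamilies. Sizes add up over blocks, and the sum is the expansion of the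
  product.\<close>

lemma sum_power_card_Union:
  fixes x :: "'a :: comm_semiring_1"
  assumes fin: "finite P" "\<And>B. B \<in> P \<Longrightarrow> finite B" and disj: "pairwise disjnt P" and ne: "{} \<notin> P"
  shows "(\<Sum>\<Omega>\<in>Union ` Pow P. x ^ card \<Omega>) = (\<Prod>B\<in>P. 1 + x ^ card B)"
proof -
  have disjointD: "C = B" if "B \<in> P" "C \<in> P" "y \<in> B" "y \<in> C" for B C y
    using disj that unfolding pairwise_def disjnt_iff by blast
  have "Q \<subseteq> R" if QR: "Q \<subseteq> P" "R \<subseteq> P" "\<Union>Q = \<Union>R" for Q R
  proof
    fix B assume B: "B \<in> Q"
    then obtain y where y: "y \<in> B" using ne QR(1) by (metis all_not_in_conv subsetD)
    then obtain C where C: "C \<in> R" "y \<in> C" using B QR(3) by blast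
    then have "C = B" using y B QR disjointD by blast
    then show "B \<in> R" using C by simp
  qed
  then have inj: "inj_on Union (Pow P)" by (intro inj_onI equalityI) auto
  have card: "card (\<Union>Q) = (\<Sum>B\<in>Q. card B)" if "Q \<subseteq> P" for Q
    using that fin pairwise_subset[OF disj that] by (intro card_Union_disjoint) auto
  have "(\<Sum>\<Omega>\<in>Union ` Pow P. x ^ card \<Omega>) = (\<Sum>Q\<in>Pow P. x ^ card (\<Union>Q))"
    by (simp add: sum.reindex[OF inj])
  also have "\<dots> = (\<Sum>Q\<in>Pow P. (\<Prod>B\<in>Q. x ^ card B) * (\<Prod>B\<in>P - Q. 1))"
    by (intro sum.cong refl) (simp add: card power_sum)
  also have "\<dots> = (\<Prod>B\<in>P. x ^ card B + 1)"
    by (rule prod_add[symmetric]) (rule fin)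
  finally show ?thesis by (simp add: add.commute)
qed

text \<open>The members are natural numbers not reduced modulo \<open>n\<close>, so that the same
  set can be reduced modulo every divisor of \<open>n\<close>. Being a monoid suffices for orbits to
  form a partition, since Euler's theorem supplies inverses modulo \<open>n\<close>.\<close>

locale unit_submonoid =
  fixes n :: nat and M :: "nat set"
  assumes n_pos: "n > 0"
    and one_closed: "1 \<in> M"
    and mult_closed: "u \<in> M \<Longrightarrow> v \<in> M \<Longrightarrow> u * v \<in> M"
    and coprime: "v \<in> M \<Longrightarrow> coprime v n"
begin

definition orb :: "nat \<Rightarrow> nat set" where
  "orb y = (\<lambda>v. (v * y) mod n) ` M"

definition invariant :: "nat set \<Rightarrow> bool" where
  "invariant \<Omega> \<longleftrightarrow> (\<forall>v\<in>M. dilate n v \<Omega> \<subseteq> \<Omega>)"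

text \<open>For \<open>m\<close> dividing \<open>n\<close> this is the order of the image of
  \<open>M\<close> in the units modulo \<open>m\<close>, which turns out to be the length of the
  orbit of any element of additive order \<open>m\<close>.\<close>

definition orb_size :: "nat \<Rightarrow> nat" where
  "orb_size m = card ((\<lambda>v. v mod m) ` M)"

lemma power_closed: "v \<in> M \<Longrightarrow> v ^ k \<in> M"
  by (induction k) (use one_closed mult_closed in auto)

lemma inverse_ex:
  assumes "v \<in> M"
  shows "\<exists>w\<in>M. [w * v = 1] (mod n)"
\<comment> \<open>Euler's theorem makes this power of \<open>v\<close> its inverse modulo
  \<open>n\<close>, and it stays in the monoid.\<close>
proof (rule bexI[of _ "v ^ (totient n - 1)"])
  have "v ^ (totient n - 1) * v = v ^ totient n"
    using n_pos by (intro power_minus_mult) simp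
  then show "[v ^ (totient n - 1) * v = 1] (mod n)"
    using euler_theorem[OF coprime[OF assms]] by simp
qed (rule power_closed[OF assms])

lemma orb_self: "y < n \<Longrightarrow> y \<in> orb y"
  unfolding orb_def using one_closed by (intro image_eqI[of _ _ 1]) auto

lemma orb_subset:
  assumes "z \<in> orb y"
  shows "orb z \<subseteq> orb y"
proof
  fix t assume "t \<in> orb z"
  then obtain v w where vw: "v \<in> M" "w \<in> M" "t = v * (w * y mod n) mod n"
    using assms by (auto simp: orb_def)
  then have "t = (v * w * y) mod n" by (simp add: mod_simps mult.assoc)
  then show "t \<in> orb y" using vw mult_closed by (auto simp: orb_def)
qed

lemma orb_eq:
  assumes "z \<in> orb y" "y < n"
  shows "orb z = orb y"
proof
  obtain v where v: "v \<in> M" "z = v * y mod n" using assms by (auto simp: orb_def)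
  obtain w where w: "w \<in> M" "[w * v = 1] (mod n)" using inverse_ex v by blast
  have "w * z mod n = (w * v) * y mod n" by (simp add: v mod_simps mult.assoc)
  also have "\<dots> = y" using cong_mult[OF w(2) cong_refl[of y]] assms by (simp add: cong_def)
  finally have "y \<in> orb z" using w by (auto simp: orb_def)
  then show "orb y \<subseteq> orb z" by (rule orb_subset)
qed (rule orb_subset[OF assms(1)])

lemma orb_disjoint: "S \<subseteq> {0..<n} \<Longrightarrow> pairwise disjnt (orb ` S)"
  unfolding pairwise_def disjnt_iff
proof (intro ballI impI notI allI)
  fix A B z
  assume "S \<subseteq> {0..<n}" "A \<in> orb ` S" "B \<in> orb ` S" "A \<noteq> B" "z \<in> A \<and> z \<in> B"
  then obtain y y' where "A = orb y" "B = orb y'" "y < n" "y' < n"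
    by (meson atLeastLessThan_iff imageE subsetD)
  then show False using orb_eq[of z y] orb_eq[of z y'] \<open>A \<noteq> B\<close> \<open>z \<in> A \<and> z \<in> B\<close> by simp
qed

text \<open>An invariant set contains the orbit of each of its elements, and each element lies in
  its own orbit because 1 belongs to \<open>M\<close>.\<close>

lemma invariant_iff_Union_orb:
  assumes S: "S \<subseteq> {0..<n}" "invariant S"
  shows "{\<Omega>. \<Omega> \<subseteq> S \<and> invariant \<Omega>} = Union ` Pow (orb ` S)"
proof (intro equalityI subsetI)
  fix \<Omega> assume "\<Omega> \<in> {\<Omega>. \<Omega> \<subseteq> S \<and> invariant \<Omega>}"
  then have \<Omega>: "\<Omega> \<subseteq> S" "invariant \<Omega>" by auto
  have "orb y \<subseteq> \<Omega>" if "y \<in> \<Omega>" for y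
    using \<Omega>(2) that by (auto simp: orb_def invariant_def dilate_def)
  moreover have "y \<in> orb y" if "y \<in> \<Omega>" for y
    using \<Omega>(1) S(1) that orb_self by auto
  ultimately have "\<Omega> = \<Union>(orb ` \<Omega>)" by blast
  then show "\<Omega> \<in> Union ` Pow (orb ` S)" using \<Omega>(1) by blast
next
  fix \<Omega> assume "\<Omega> \<in> Union ` Pow (orb ` S)"
  then obtain T where T: "T \<subseteq> S" "\<Omega> = \<Union>(orb ` T)" by (auto simp: subset_image_iff)
  have "orb y \<subseteq> S" if "y \<in> S" for y using S(2) that by (auto simp: orb_def invariant_def dilate_def)
  moreover have "invariant \<Omega>" unfolding invariant_def dilate_def T(2)
  proof clarify
    fix v y z assume "v \<in> M" "y \<in> T" "z \<in> orb y"
    then have "v * z mod n \<in> orb y" using orb_subset[of z y] by (auto simp: orb_def)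
    then show "v * z mod n \<in> \<Union>(orb ` T)" using \<open>y \<in> T\<close> by blast
  qed
  ultimately show "\<Omega> \<in> {\<Omega>. \<Omega> \<subseteq> S \<and> invariant \<Omega>}" using T by blast
qed

lemma sum_invariant:
  fixes x :: "'a :: comm_semiring_1"
  assumes S: "S \<subseteq> {0..<n}" "invariant S"
  shows "(\<Sum>\<Omega> | \<Omega> \<subseteq> S \<and> invariant \<Omega>. x ^ card \<Omega>) = (\<Prod>B\<in>orb ` S. 1 + x ^ card B)"
  unfolding invariant_iff_Union_orb[OF S]
proof (rule sum_power_card_Union)
  show "finite (orb ` S)" using S finite_subset by blast
  show "finite B" if "B \<in> orb ` S" for B
    using that n_pos by (auto simp: orb_def intro: finite_subset[of _ "{0..<n}"])
  show "{} \<notin> orb ` S" using one_closed by (auto simp: orb_def)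
qed (rule orb_disjoint[OF S(1)])

text \<open>Write \<open>y = d * t\<close> and \<open>n = d * m\<close> with \<open>t\<close>
  coprime to \<open>m\<close>. Then \<open>v * y mod n = d * (v * t mod m)\<close>, which depends on
  \<open>v mod m\<close> only and determines it.\<close>

lemma card_orb:
  assumes "m = n div gcd y n"
  shows "card (orb y) = orb_size m"
proof -
  define d where "d = gcd y n"
  have d: "d > 0" "n = d * m" using n_pos assms by (auto simp: d_def)
  obtain t where t: "y = d * t" by (metis d_def dvd_def gcd_dvd1)
  have "coprime t m"
    using d t d_def by (metis gcd_mult_distrib_nat mult_cancel1 mult.right_neutral coprime_iff_gcd_eq_1 less_not_refl)
  have "inj_on (\<lambda>k. d * (k * t mod m)) ((\<lambda>v. v mod m) ` M)"
  proof (rule inj_onI)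
    fix k l assume kl: "k \<in> (\<lambda>v. v mod m) ` M" "l \<in> (\<lambda>v. v mod m) ` M"
      and eq: "d * (k * t mod m) = d * (l * t mod m)"
    from eq d have "[k * t = l * t] (mod m)" by (simp add: cong_def)
    then have "[k = l] (mod m)" using \<open>coprime t m\<close> by (simp add: cong_mult_rcancel_nat)
    then show "k = l" using kl by (auto simp: cong_def)
  qed
  moreover have "d * (v mod m * t mod m) = v * y mod n" for v
  proof -
    have "d * (v mod m * t mod m) = (d * (v * t)) mod (d * m)"
      by (simp only: mod_mult_left_eq mult_mod_right)
    then show ?thesis by (simp only: t d(2)[symmetric] mult.left_commute)
  qed
  then have "(\<lambda>k. d * (k * t mod m)) ` ((\<lambda>v. v mod m) ` M) = orb y"
    by (simp only: orb_def image_image)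
  ultimately show ?thesis unfolding orb_size_def using card_image by metis
qed

text \<open>Multiplication by a unit preserves the additive order \<open>n div gcd y n\<close>;
  hence each order class is a union of orbits.\<close>

lemma gcd_unit_mult:
  assumes "v \<in> M"
  shows "gcd (v * y mod n) n = gcd y n"
proof -
  have "gcd (v * y mod n) n = gcd (v * y) n" by (metis gcd.commute gcd_red_nat)
  also have "\<dots> = gcd y n"
    using coprime[OF assms] by (simp add: gcd_mult_left_left_cancel coprime_commute)
  finally show ?thesis .
qed

lemma unit_mult_range:
  assumes "v \<in> M" "y \<in> {1..<n}"
  shows "v * y mod n \<in> {1..<n}"
proof -
  have "gcd y n < n" using assms(2) le_less_trans[OF gcd_le1_nat[of y n]] by simp
  then have "v * y mod n \<noteq> 0" using gcd_unit_mult[OF assms(1), of y] by (metis gcd_0_left_nat less_irrefl)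
  then show ?thesis using n_pos by auto
qed

section \<open>Orbits sorted by additive order\<close>

definition order_class :: "nat \<Rightarrow> nat set" where
  "order_class m = {y\<in>{1..<n}. n div gcd y n = m}"

lemma card_order_class:
  assumes "m dvd n" "m \<noteq> 1"
  shows "card (order_class m) = totient m"
proof -
  have "order_class m = {y\<in>{0<..n}. gcd y n = n div m}"
  proof (intro equalityI subsetI)
    fix y assume y: "y \<in> {y\<in>{0<..n}. gcd y n = n div m}"
    obtain k where k: "n = m * k" using assms(1) by (rule dvdE)
    \<comment> \<open>The library count runs over \<open>{0<..n}\<close>; the extra point
      \<open>y = n\<close> is excluded because its order would be 1.\<close>
    then have "n div m \<noteq> n" "n div (n div m) = m" using assms(2) n_pos by auto
    then show "y \<in> order_class m" using y by (cases "y = n") (auto simp: order_class_def)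
  next
    fix y assume "y \<in> order_class m"
    then show "y \<in> {y\<in>{0<..n}. gcd y n = n div m}"
      using n_pos div_div_eq_right[of "gcd y n" n n] by (simp add: order_class_def)
  qed
  moreover have "n div m dvd n" "n div (n div m) = m"
    using assms(1) n_pos by (metis dvd_div_mult_self dvd_triv_left, metis div_div_eq_right dvd_refl div_self mult_1 less_not_refl)
  ultimately show ?thesis
    using card_gcd_eq_totient[OF n_pos, of "n div m"] by simp
qed

lemma prod_orb_order_class:
  fixes x :: "'a :: comm_semiring_1"
  assumes m: "m dvd n" "m \<noteq> 1"
  shows "(\<Prod>B\<in>orb ` order_class m. 1 + x ^ card B) = (1 + x ^ orb_size m) ^ (totient m div orb_size m)"
proof -
  have sub: "order_class m \<subseteq> {0..<n}" by (auto simp: order_class_def)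
  then have fin: "finite (orb ` order_class m)" using finite_subset by blast
  have card: "card B = orb_size m" if "B \<in> orb ` order_class m" for B
  proof -
    obtain y where "y \<in> order_class m" "B = orb y" using \<open>B \<in> _\<close> by blast
    then show ?thesis using card_orb[of m y] by (simp add: order_class_def)
  qed
  have "orb y \<subseteq> order_class m" if y: "y \<in> order_class m" for y
  proof
    fix z assume "z \<in> orb y"
    then obtain v where v: "v \<in> M" "z = v * y mod n" by (auto simp: orb_def)
    then have g: "gcd z n = gcd y n" by (simp add: gcd_unit_mult)
    then show "z \<in> order_class m" using y v unit_mult_range[of v y] by (simp add: order_class_def)
  qed
  then have Un: "\<Union>(orb ` order_class m) = order_class m"
  proof (intro equalityI subsetI)
    fix y assume y: "y \<in> order_class m"
    then have "y \<in> orb y" using sub by (intro orb_self) auto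
    then show "y \<in> \<Union>(orb ` order_class m)" using y by blast
  qed blast
  have "orb_size m * card (orb ` order_class m) = card (\<Union>(orb ` order_class m))"
  proof (rule card_partition[OF fin])
    show "finite (\<Union>(orb ` order_class m))" unfolding Un using finite_subset[OF sub] by simp
    show "A \<inter> B = {}" if "A \<in> orb ` order_class m" "B \<in> orb ` order_class m" "A \<noteq> B" for A B
      using orb_disjoint[OF sub] that unfolding pairwise_def disjnt_def by blast
  qed (rule card)
  then have eq: "orb_size m * card (orb ` order_class m) = totient m"
    by (simp only: Un card_order_class[OF m])
  moreover have "m > 0" using m(1) n_pos by (rule dvd_pos_nat[rotated])
  then have "totient m > 0" by simp
  \<comment> \<open>Since \<open>totient m\<close> is positive, \<open>orb_size m\<close> cannot
    vanish, and the division is exact.\<close>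
  ultimately have "card (orb ` order_class m) = totient m div orb_size m"
    by (cases "orb_size m = 0") (simp_all flip: eq)
  then show ?thesis by (simp add: card)
qed

text \<open>The ground set is the subgroup of order \<open>e\<close> without 0; dropping 0 removes
  the factor for \<open>m = 1\<close>. Its orbits split according to the additive order of their
  elements.\<close>

theorem sum_invariant_order_dvd:
  fixes x :: "'a :: comm_semiring_1"
  assumes e: "e dvd n"
  shows "(\<Sum>\<Omega> | \<Omega> \<subseteq> {y\<in>{1..<n}. n div gcd y n dvd e} \<and> invariant \<Omega>. x ^ card \<Omega>) =
    (\<Prod>m | m dvd e \<and> m \<noteq> 1. (1 + x ^ orb_size m) ^ (totient m div orb_size m))"
proof -
  define S where "S = {y\<in>{1..<n}. n div gcd y n dvd e}"
  define D where "D = {m. m dvd e \<and> m \<noteq> 1}"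
  have D: "m dvd n" "m \<noteq> 1" if "m \<in> D" for m using that e by (auto simp: D_def)
  have "e > 0" using e n_pos by (auto intro!: Nat.gr0I)
  then have finD: "finite D" by (simp add: D_def)
  have "n div gcd y n \<noteq> 1" if "y \<in> {1..<n}" for y
  proof (rule notI)
    assume "n div gcd y n = 1"
    then have "gcd y n = n" by (metis dvd_div_mult_self gcd_dvd2 mult_1)
    then show False using that le_less_trans[OF gcd_le1_nat[of y n], of n] by simp
  qed
  then have S: "S = (\<Union>m\<in>D. order_class m)" by (auto simp: S_def D_def order_class_def)
  have sub: "S \<subseteq> {0..<n}" by (auto simp: S_def)
  have inv: "invariant S"
    unfolding invariant_def dilate_def
  proof clarify
    fix v y assume v: "v \<in> M" and y: "y \<in> S"
    have g: "gcd (v * y mod n) n = gcd y n" using v by (rule gcd_unit_mult)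
    then show "v * y mod n \<in> S" using y v unit_mult_range[of v y] by (simp add: S_def)
  qed
  have "orb ` S = (\<Union>m\<in>D. orb ` order_class m)" by (auto simp: S)
  moreover have "(\<Prod>B\<in>(\<Union>m\<in>D. orb ` order_class m). 1 + x ^ card B) =
      (\<Prod>m\<in>D. \<Prod>B\<in>orb ` order_class m. 1 + x ^ card B)"
  proof (rule prod.UNION_disjoint[OF finD])
    show "\<forall>m\<in>D. finite (orb ` order_class m)"
      by (auto simp: order_class_def)
    \<comment> \<open>An orbit determines its order class, because the gcd with \<open>n\<close> is
      constant along it.\<close>
    show "\<forall>m\<in>D. \<forall>m'\<in>D. m \<noteq> m' \<longrightarrow> orb ` order_class m \<inter> orb ` order_class m' = {}"
    proof (intro ballI impI)
      fix m m' :: nat assume "m \<noteq> m'"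
      have "m = m'" if yz: "y \<in> order_class m" "z \<in> order_class m'" "orb y = orb z" for y z
      proof -
        have *: "n div gcd y n = m" "n div gcd z n = m'" "z < n"
          using yz by (auto simp: order_class_def)
        then obtain v where "v \<in> M" "z = v * y mod n"
          using orb_self[of z] yz(3) unfolding orb_def by blast
        then have "gcd z n = gcd y n" by (simp add: gcd_unit_mult)
        then show ?thesis using * by simp
      qed
      then show "orb ` order_class m \<inter> orb ` order_class m' = {}" using \<open>m \<noteq> m'\<close> by blast
    qed
  qed
  ultimately have "(\<Prod>B\<in>orb ` S. 1 + x ^ card B) =
      (\<Prod>m\<in>D. (1 + x ^ orb_size m) ^ (totient m div orb_size m))"
    using D by (simp add: prod_orb_order_class)
  then show ?thesis using sum_invariant[OF sub inv, of x] by (simp add: S_def D_def)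
qed

end

section \<open>Sums over gcds and powers of primitive roots\<close>

lemma sum_gcd_eq_sum_dvd:
  fixes h :: "nat \<Rightarrow> 'a :: semiring_1"
  assumes N: "N > 0"
  shows "(\<Sum>j<N. h (gcd j N)) = (\<Sum>d | d dvd N. of_nat (totient (N div d)) * h d)"
proof -
  \<comment> \<open>The index 0 is traded for \<open>N\<close>, which has the same gcd with
    \<open>N\<close>; the totient count is available for the range \<open>{0<..N}\<close>.\<close>
  have "(\<Sum>j<N. h (gcd j N)) = (\<Sum>j\<in>{0<..N}. h (gcd j N))"
    by (rule sum.reindex_bij_witness[of _ "\<lambda>j. if j = N then 0 else j" "\<lambda>j. if j = 0 then N else j"])
      (use N in auto)
  also have "\<dots> = (\<Sum>d | d dvd N. \<Sum>j\<in>{j\<in>{0<..N}. gcd j N = d}. h (gcd j N))"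
    by (rule sum.group[symmetric]) (use N in auto)
  also have "\<dots> = (\<Sum>d | d dvd N. of_nat (totient (N div d)) * h d)"
  proof (intro sum.cong refl)
    fix d assume "d \<in> {d. d dvd N}"
    then show "(\<Sum>j\<in>{j\<in>{0<..N}. gcd j N = d}. h (gcd j N)) = of_nat (totient (N div d)) * h d"
      using card_gcd_eq_totient[OF N, of d] by simp
  qed
  finally show ?thesis .
qed

text \<open>Shifting a logarithm \<open>j\<close> by \<open>M\<close> changes its gcd with
  \<open>2 * M\<close> in a way that depends on \<open>d = gcd j (2 * M)\<close> only; for
  \<open>2 * M = p - 1\<close> the new value is g_d. Write \<open>j = t * d\<close> and
  \<open>2 * M = k * d\<close> with \<open>t\<close> coprime to \<open>k\<close>: after removing a
  common factor, the remaining gcd depends on the parities of \<open>k\<close> and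
  \<open>k div 2\<close>, not on \<open>t\<close>.\<close>

lemma gcd_add_half:
  fixes j M :: nat
  assumes M: "M > 0"
  shows "gcd (j + M) (2 * M) = gcd (M + gcd j (2 * M)) (2 * M)"
proof -
  define d where "d = gcd j (2 * M)"
  have "d > 0" using M by (simp add: d_def)
  obtain t k where t: "j = t * d" "2 * M = k * d" "coprime t k"
    using gcd_coprime_exists[of j "2 * M", folded d_def] \<open>d > 0\<close> by blast
  show ?thesis
  proof (cases "even k")
    case True
    then obtain l where l: "k = 2 * l" by blast
    then have M': "M = l * d" using t(2) by simp
    have "odd t" using t(3) l by (auto simp: coprime_right_2_iff_odd)
    have l0: "coprime t l" using t(3) l by (simp add: coprime_mult_right_iff)
    \<comment> \<open>A general \<open>s\<close> is needed because the claim is applied to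
      \<open>s = t\<close> for the left side and to \<open>s = 1\<close> for the right side.\<close>
    have *: "gcd (s + l) (2 * l) = (if odd l then 2 else 1)" if "coprime s l" "odd s" for s
    proof -
      have "coprime (s + l) l" using that(1) unfolding coprime_iff_gcd_eq_1 gcd_add1 .
      then have "gcd (s + l) (2 * l) = gcd (s + l) 2"
        by (rule gcd_mult_right_right_cancel)
      also have "\<dots> = (if odd l then 2 else 1)"
      proof (cases "odd l")
        case True
        then have "2 dvd s + l" using that(2) by simp
        then show ?thesis using True by (simp add: gcd_nat.absorb2)
      next
        case False
        then have "coprime (s + l) 2" using that(2) by (simp add: coprime_right_2_iff_odd)
        then show ?thesis using False by (simp add: coprime_imp_gcd_eq_1)
      qed
      finally show ?thesis .
    qed
    have "j + M = d * (t + l)" "M + d = d * (1 + l)" "2 * M = d * (2 * l)"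
      using t(1) M' by (simp_all add: algebra_simps)
    then show ?thesis
      using *[OF l0 \<open>odd t\<close>] *[OF coprime_1_left odd_one] unfolding d_def[symmetric]
      by (simp only: gcd_mult_distrib_nat[symmetric])
  next
    case False
    \<comment> \<open>With \<open>k\<close> odd, the factor 2 of \<open>2 * M\<close> sits in
      \<open>d\<close>, so only half of \<open>d\<close> can be factored out of
      \<open>M\<close>.\<close>
    then have "even d" using t(2) by (metis dvd_triv_left even_mult_iff)
    then obtain e where e: "d = 2 * e" by blast
    then have M': "M = k * e" using t(2) by simp
    have *: "gcd (2 * s + k) (2 * k) = 1" if "coprime s k" for s
    proof -
      have "coprime (2 * s) k"
        using that False by (simp add: coprime_mult_left_iff coprime_left_2_iff_odd)
      then have "coprime (2 * s + k) k" unfolding coprime_iff_gcd_eq_1 gcd_add1 .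
      moreover have "coprime (2 * s + k) 2" using False by (simp add: coprime_right_2_iff_odd)
      ultimately show ?thesis by (simp add: coprime_imp_gcd_eq_1)
    qed
    have "j + M = e * (2 * t + k)" "M + d = e * (2 * 1 + k)" "2 * M = e * (2 * k)"
      using t(1) M' e by (simp_all add: algebra_simps)
    then show ?thesis
      using *[OF t(3)] *[OF coprime_1_left] unfolding d_def[symmetric]
      by (simp only: gcd_mult_distrib_nat[symmetric])
  qed
qed

section \<open>Powers modulo \<open>m\<close> and primitive roots\<close>

lemma card_range_power_mod:
  fixes a m :: nat
  assumes "coprime m a"
  shows "card (range (\<lambda>k. a ^ k mod m)) = ord m a"
proof -
  have pos: "ord m a > 0" using assms by simp
  have "range (\<lambda>k. a ^ k mod m) = (\<lambda>k. a ^ k mod m) ` {..<ord m a}"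
  proof (intro equalityI subsetI)
    fix y assume "y \<in> range (\<lambda>k. a ^ k mod m)"
    then obtain k where k: "y = a ^ k mod m" by blast
    have "[a ^ k = a ^ (k mod ord m a)] (mod m)"
      using order_divides_expdiff[OF assms] by (simp add: cong_def)
    then show "y \<in> (\<lambda>k. a ^ k mod m) ` {..<ord m a}"
      using k pos by (auto simp: cong_def)
  qed auto
  then show ?thesis using inj_power_mod[OF assms] by (simp add: card_image)
qed

text \<open>This identifies \<open>M\<close> as the discrete logarithm of -1. The power
  \<open>r ^ M\<close> squares to 1 but is not 1, as \<open>r\<close> has order
  \<open>2 * M\<close>, and modulo a prime only -1 is left.\<close>

lemma primroot_power_half:
  fixes p r M :: nat
  assumes "prime p" "odd p" "residue_primroot p r" "p - 1 = 2 * M"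
  shows "[r ^ M = p - 1] (mod p)"
proof -
  have p: "p > 2" using assms(1,2) prime_gt_1_nat[of p] by (cases "p = 2") auto
  have ord: "ord p r = 2 * M" and cop: "coprime p r"
    using assms by (auto simp: residue_primroot_def totient_prime)
  \<comment> \<open>Over the integers \<open>w * w - 1\<close> factors without truncated
    subtraction.\<close>
  define w where "w = int (r ^ M)"
  have "w * w = int (r ^ ord p r)" by (simp add: w_def ord mult_2 power_add)
  then have "[w * w = 1] (mod int p)"
    by (metis cong_int_iff of_nat_1 Pocklington.ord)
  then have "int p dvd (w - 1) * (w + 1)"
    by (simp add: cong_iff_dvd_diff algebra_simps)
  moreover have "\<not> int p dvd w - 1"
  proof
    assume "int p dvd w - 1"
    then have "[r ^ M = 1] (mod p)"
      using cong_int_iff[of "r ^ M" 1 p] by (simp add: w_def cong_iff_dvd_diff)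
    then have "2 * M dvd M" using ord_divides[of r M p] ord by simp
    then show False using p assms(4) by (auto dest: dvd_imp_le)
  qed
  ultimately have "int p dvd w + 1" using assms(1) by (simp add: prime_dvd_mult_iff)
  then have "int p dvd (w + 1) - int p" by simp
  then have "[w = int (p - 1)] (mod int p)"
    using p by (simp add: cong_iff_dvd_diff of_nat_diff algebra_simps)
  then show ?thesis by (simp add: w_def cong_int_iff del: of_nat_power)
qed

section \<open>Connection sets fixed by a unit\<close>

definition neg_span :: "nat \<Rightarrow> nat \<Rightarrow> nat set" where
  "neg_span n u = {u ^ a * (n - 1) ^ b | a b. True}"

lemma unit_submonoid_neg_span:
  assumes "n > 0" "coprime u n"
  shows "unit_submonoid n (neg_span n u)"
proof
  show "1 \<in> neg_span n u" unfolding neg_span_def by (auto intro!: exI[of _ 0])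
  fix v w assume "v \<in> neg_span n u" "w \<in> neg_span n u"
  then obtain a b c d where "v = u ^ a * (n - 1) ^ b" "w = u ^ c * (n - 1) ^ d"
    unfolding neg_span_def by blast
  then have "v * w = u ^ (a + c) * (n - 1) ^ (b + d)" by (simp only: power_add mult_ac)
  then show "v * w \<in> neg_span n u" unfolding neg_span_def by blast
next
  fix v assume "v \<in> neg_span n u"
  then obtain a b where "v = u ^ a * (n - 1) ^ b" unfolding neg_span_def by blast
  moreover have "coprime (u ^ a) n" using assms(2) by simp
  moreover have "coprime ((n - 1) ^ b) n" using coprime_diff_one_left_nat[OF assms(1)] by simp
  ultimately show "coprime v n" by (simp only: coprime_mult_left_iff)
qed (rule assms(1))

lemma dilate_mult: "dilate n (u * v) \<Omega> = dilate n u (dilate n v \<Omega>)"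
  unfolding dilate_dilate dilate_mod ..

lemma dilate_power_fixed:
  assumes "\<Omega> \<subseteq> {0..<n}" "dilate n u \<Omega> = \<Omega>"
  shows "dilate n (u ^ k) \<Omega> = \<Omega>"
proof (induction k)
  case 0
  then show ?case using dilate_one[OF assms(1)] by simp
next
  case (Suc k)
  then show ?case by (simp only: power_Suc dilate_mult assms(2))
qed

lemma dilate_eqI:
  assumes "\<Omega> \<subseteq> {0..<n}" "coprime u n" "dilate n u \<Omega> \<subseteq> \<Omega>"
  shows "dilate n u \<Omega> = \<Omega>"
  using assms card_dilate[OF assms(2,1)] finite_subset[OF assms(1)]
  by (intro card_subset_eq) auto

text \<open>Symmetry and invariance under \<open>u\<close> merge into invariance under one monoid.
  Invariance is stated as an inclusion; for a unit acting on a finite set it becomes equality by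
  counting.\<close>

lemma fixed_iff_invariant:
  assumes n: "n > 0" and u: "coprime u n" and \<Omega>: "\<Omega> \<subseteq> {0..<n}"
  shows "dilate n (n - 1) \<Omega> = \<Omega> \<and> dilate n u \<Omega> = \<Omega> \<longleftrightarrow>
           unit_submonoid.invariant n (neg_span n u) \<Omega>"
proof -
  interpret unit_submonoid n "neg_span n u" using unit_submonoid_neg_span[OF n u] .
  show ?thesis
  proof
    assume *: "dilate n (n - 1) \<Omega> = \<Omega> \<and> dilate n u \<Omega> = \<Omega>"
    have "dilate n (u ^ a * (n - 1) ^ b) \<Omega> = \<Omega>" for a b
      using * dilate_power_fixed[OF \<Omega>] by (simp only: dilate_mult)
    then show "invariant \<Omega>" unfolding invariant_def by (auto simp: neg_span_def)
  next
    assume inv: "invariant \<Omega>"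
    have "u ^ 1 * (n - 1) ^ 0 \<in> neg_span n u" "u ^ 0 * (n - 1) ^ 1 \<in> neg_span n u"
      unfolding neg_span_def by blast+
    then have "u \<in> neg_span n u" "n - 1 \<in> neg_span n u" by simp_all
    then show "dilate n (n - 1) \<Omega> = \<Omega> \<and> dilate n u \<Omega> = \<Omega>"
      using inv dilate_eqI[OF \<Omega>] u coprime_diff_one_left_nat[OF n] unfolding invariant_def by blast
  qed
qed

lemma dilate_neg_fixed:
  assumes "dilate n (n - 1) \<Omega> = \<Omega>"
  shows "dilate n (u * (n - 1)) \<Omega> = dilate n u \<Omega>"
  by (simp only: dilate_mult assms)

text \<open>The multiples of \<open>q\<close> form the subgroup of order \<open>n div q\<close>.
  This translates the prime criterion for generation into conditions on additive orders.\<close>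

lemma order_dvd_div_iff:
  assumes n: "n > 0" and q: "q dvd n"
  shows "n div gcd y n dvd n div q \<longleftrightarrow> q dvd (y :: nat)"
proof -
  obtain k where k: "n = q * k" using q by (rule dvdE)
  obtain h where h: "n = gcd y n * h" using gcd_dvd2 by (rule dvdE)
  have pos: "q > 0" "h > 0" "n div q = k" using n k h by (auto intro!: Nat.gr0I)
  have "n div gcd y n = h" using n h by (metis gcd_pos_nat less_not_refl nonzero_mult_div_cancel_left)
  moreover have "h dvd k \<longleftrightarrow> q dvd gcd y n"
  proof
    assume "h dvd k"
    then obtain c where "k = h * c" by (rule dvdE)
    then have "gcd y n * h = (q * c) * h" using h k by (metis mult.assoc mult.commute)
    then have "gcd y n = q * c" using pos by simp
    then show "q dvd gcd y n" by simp
  next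
    assume "q dvd gcd y n"
    then obtain c where "gcd y n = q * c" by (rule dvdE)
    then have "q * k = q * (c * h)" using h k by (metis mult.assoc)
    then show "h dvd k" using pos by simp
  qed
  ultimately show ?thesis using q pos by simp
qed

text \<open>The primes dividing \<open>4 * p\<close> are 2 and \<open>p\<close>. A set that fails to
  generate consists of even numbers (orders dividing \<open>2 * p\<close>) or of multiples of
  \<open>p\<close> (orders dividing 4), and inclusion-exclusion removes both kinds.\<close>

lemma sum_fixed_Gset:
  fixes x :: real
  assumes p: "prime p" "odd p" and u: "coprime u (4 * p)"
  defines "W \<equiv> \<lambda>e. \<Sum>\<Omega> | \<Omega> \<subseteq> {y\<in>{1..<4 * p}. 4 * p div gcd y (4 * p) dvd e} \<and>
     unit_submonoid.invariant (4 * p) (neg_span (4 * p) u) \<Omega>. x ^ card \<Omega>"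
  shows "(\<Sum>\<Omega> | \<Omega> \<in> Gset (4 * p) \<and> dilate (4 * p) u \<Omega> = \<Omega>. x ^ card \<Omega>) =
    W (4 * p) - W (2 * p) - W 4 + W 2"
proof -
  define n where "n = 4 * p"
  have n: "n > 0" and un: "coprime u n" using p prime_gt_0_nat u by (auto simp: n_def)
  define S where "S = (\<lambda>e. {y\<in>{1..<n}. n div gcd y n dvd e})"
  define I where "I = (\<lambda>e. {\<Omega>. \<Omega> \<subseteq> S e \<and> unit_submonoid.invariant n (neg_span n u) \<Omega>})"
  have W: "W e = (\<Sum>\<Omega>\<in>I e. x ^ card \<Omega>)" for e by (simp only: W_def I_def S_def n_def)
  have fin: "finite (I e)" for e
    by (rule finite_subset[of _ "Pow {1..<n}"]) (auto simp: I_def S_def)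
  have primes: "prime q \<and> q dvd n \<longleftrightarrow> q = 2 \<or> q = p" for q
  proof -
    have n4: "n = 2 * 2 * p" by (simp add: n_def)
    have "q = 2 \<or> q = p" if q: "prime q" "q dvd n"
    proof -
      have "q dvd 2 \<or> q dvd p" using q(2) prime_dvd_multD[OF q(1)] unfolding n4 by blast
      then show ?thesis using primes_dvd_imp_eq[OF q(1)] p(1) two_is_prime_nat by blast
    qed
    then show ?thesis using p(1) two_is_prime_nat by (auto simp: n_def)
  qed
  have "n div gcd y n dvd n" for y by (metis dvd_div_mult_self dvd_triv_left gcd_dvd2)
  then have S_n: "S n = {1..<n}" by (auto simp: S_def)
  have S_2p: "S (2 * p) = {y\<in>{1..<n}. 2 dvd y}"
    using order_dvd_div_iff[OF n, of 2] by (auto simp: S_def n_def)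
  have S_4: "S 4 = {y\<in>{1..<n}. p dvd y}"
    using order_dvd_div_iff[OF n, of p] p(1) by (auto simp: S_def n_def)
  \<comment> \<open>The two maximal subgroups meet in the subgroup of order gcd(2p, 4), which is 2
    for odd \<open>p\<close>.\<close>
  have "m dvd 2 \<longleftrightarrow> m dvd 2 * p \<and> m dvd 4" for m
  proof -
    have "gcd (2 * p) 4 = 2 * gcd p 2" using gcd_mult_distrib_nat[of 2 p 2] by simp
    also have "\<dots> = 2" using p(2) by (simp add: coprime_imp_gcd_eq_1 coprime_right_2_iff_odd)
    finally show ?thesis by (metis gcd_greatest_iff)
  qed
  then have S_2: "S 2 = S (2 * p) \<inter> S 4" by (auto simp: S_def)
  have "\<Omega> \<in> Gset n \<and> dilate n u \<Omega> = \<Omega> \<longleftrightarrow> \<Omega> \<in> I n - (I (2 * p) \<union> I 4)" for \<Omega>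
  proof (cases "\<Omega> \<subseteq> {1..<n}")
    case True
    then have "\<Omega> \<subseteq> {0..<n}" by auto
    then show ?thesis
      using fixed_iff_invariant[OF n un, of \<Omega>] True
      unfolding Gset_iff[OF n] primes I_def S_n S_2p S_4 by blast
  qed (auto simp: Gset_iff[OF n] I_def S_n)
  then have "{\<Omega>. \<Omega> \<in> Gset n \<and> dilate n u \<Omega> = \<Omega>} = I n - (I (2 * p) \<union> I 4)" by blast
  moreover have "I (2 * p) \<union> I 4 \<subseteq> I n" by (auto simp: I_def S_n S_2p S_4)
  moreover have "I (2 * p) \<inter> I 4 = I 2" unfolding I_def S_2 by blast
  ultimately have "(\<Sum>\<Omega> | \<Omega> \<in> Gset n \<and> dilate n u \<Omega> = \<Omega>. x ^ card \<Omega>) =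
      W n - (W (2 * p) + W 4 - W 2)"
    using fin by (simp add: W sum_diff sum_Un)
  then show ?thesis by (simp add: n_def)
qed

lemma divisors_4: "{m. m dvd 4 \<and> m \<noteq> 1} = {2, 4 :: nat}"
proof -
  have "m \<in> {2, 4}" if "m dvd 4" "m \<noteq> 1" for m :: nat
  proof -
    have "m \<le> 4" using that(1) by (rule dvd_imp_le) simp
    then have "m \<in> {0, 1, 2, 3, 4}" by auto
    then show ?thesis using that by auto
  qed
  then show ?thesis by auto
qed

lemma divisors_mult_prime:
  fixes a p :: nat
  assumes "prime p"
  shows "{m. m dvd a * p \<and> m \<noteq> 1} = insert p ({m. m dvd a \<and> m \<noteq> 1} \<union> (\<lambda>m. m * p) ` {m. m dvd a \<and> m \<noteq> 1})"
proof (intro equalityI subsetI)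
  fix m assume "m \<in> {m. m dvd a * p \<and> m \<noteq> 1}"
  then have m: "m dvd a * p" "m \<noteq> 1" by auto
  then obtain b c where "m = b * c" "b dvd a" "c dvd p" using division_decomp by blast
  moreover have "c = 1 \<or> c = p" using \<open>c dvd p\<close> assms by (simp add: prime_nat_iff)
  ultimately show "m \<in> insert p ({m. m dvd a \<and> m \<noteq> 1} \<union> (\<lambda>m. m * p) ` {m. m dvd a \<and> m \<noteq> 1})"
    using m(2) by auto
next
  fix m assume "m \<in> insert p ({m. m dvd a \<and> m \<noteq> 1} \<union> (\<lambda>m. m * p) ` {m. m dvd a \<and> m \<noteq> 1})"
  moreover have "p \<noteq> 1" using assms by auto
  ultimately show "m \<in> {m. m dvd a * p \<and> m \<noteq> 1}" by auto
qed

section \<open>Orbit sizes modulo \<open>4p\<close>\<close>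

text \<open>As \<open>n - 1\<close> squares to 1 modulo \<open>n\<close>, only the parity of its
  exponent matters.\<close>

lemma neg_span_mod:
  assumes n: "n > 0"
  shows "(\<lambda>v. v mod n) ` neg_span n u =
    range (\<lambda>k. u ^ k mod n) \<union> (\<lambda>y. (n - 1) * y mod n) ` range (\<lambda>k. u ^ k mod n)"
proof -
  define A where "A = range (\<lambda>k. u ^ k mod n)"
  define neg where "neg = (\<lambda>y. (n - 1) * y mod n)"
  have sq: "[(n - 1) * (n - 1) = 1] (mod n)"
  proof (cases "n = 1")
    case False
    then obtain k where k: "n = Suc (Suc k)" using n by (cases n; cases "n - 1") auto
    have "(n - 1) * (n - 1) = 1 + n * k" unfolding k by simp
    then show ?thesis by (simp only: cong_def mod_mult_self2)
  qed simp
  have "(\<lambda>v. v mod n) ` neg_span n u = A \<union> neg ` A"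
  proof (intro equalityI subsetI)
    fix y assume "y \<in> (\<lambda>v. v mod n) ` neg_span n u"
    then obtain a b where y: "y = (u ^ a * (n - 1) ^ b) mod n" unfolding neg_span_def by blast
    show "y \<in> A \<union> neg ` A"
    proof (cases "even b")
      case True
      then obtain c where "b = 2 * c" by (rule evenE)
      then have "[(n - 1) ^ b = 1 ^ c] (mod n)"
        using cong_pow[OF sq, of c] by (simp only: power_mult power2_eq_square)
      then have "y = u ^ a mod n" using cong_scalar_left[of "(n - 1) ^ b" "1 ^ c" n "u ^ a"]
        by (simp add: y cong_def)
      then show ?thesis by (auto simp: A_def)
    next
      case False
      then obtain c where c: "b = 2 * c + 1" by (rule oddE)
      then have "(n - 1) ^ b = ((n - 1) * (n - 1)) ^ c * (n - 1)"
        by (simp only: power_add power_mult power2_eq_square power_one_right)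
      moreover have "[((n - 1) * (n - 1)) ^ c * (n - 1) = 1 ^ c * (n - 1)] (mod n)"
        by (intro cong_mult cong_pow sq cong_refl)
      ultimately have "[u ^ a * (n - 1) ^ b = u ^ a * (n - 1)] (mod n)"
        by (metis cong_scalar_left mult_1 power_one)
      then have "y = neg (u ^ a mod n)"
        by (simp only: y neg_def cong_def mod_mult_right_eq mult.commute)
      then show ?thesis by (auto simp: A_def)
    qed
  next
    fix y assume "y \<in> A \<union> neg ` A"
    then obtain a b where "y = (u ^ a * (n - 1) ^ b) mod n"
    proof
      assume "y \<in> A"
      then obtain k where "y = u ^ k mod n" by (auto simp: A_def)
      then show ?thesis using that[of k 0] by simp
    next
      assume "y \<in> neg ` A"
      then obtain k where "y = (n - 1) * (u ^ k mod n) mod n" by (auto simp: A_def neg_def)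
      then show ?thesis using that[of k 1] by (simp only: mod_mult_right_eq mult.commute power_one_right)
    qed
    then show "y \<in> (\<lambda>v. v mod n) ` neg_span n u" unfolding neg_span_def by blast
  qed
  then show ?thesis by (simp only: A_def neg_def)
qed

locale odd_prime_primroot =
  fixes p r M :: nat
  assumes prime: "prime p" and odd: "odd p" and primroot: "residue_primroot p r"
    and M: "p - 1 = 2 * M"
begin

lemma p_eq: "p = 2 * M + 1" and M_pos: "M > 0"
proof -
  show "p = 2 * M + 1" using M prime_gt_1_nat[OF prime] by simp
  then show "M > 0" using prime_gt_1_nat[OF prime] by (cases M) auto
qed

lemma coprime_p_r: "coprime p r" and ord_r: "ord p r = 2 * M"
  using primroot prime M by (auto simp: residue_primroot_def totient_prime)

lemma coprime_4_p: "coprime 4 p"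
  using odd coprime_power_left_iff[of 2 2 p] by (simp add: coprime_left_2_iff_odd)

lemma coprime_p_if_cong_power: "[u = r ^ i] (mod p) \<Longrightarrow> coprime u p"
  using coprime_p_r by (metis cong_imp_coprime cong_sym coprime_commute coprime_power_left_iff)

lemma minus_one_cong: "[4 * p - 1 = r ^ M] (mod p)"
proof -
  have "4 * p - 1 = (p - 1) + 3 * p" using p_eq by simp
  then have "[4 * p - 1 = p - 1] (mod p)" by (simp add: cong_def)
  then show ?thesis using primroot_power_half[OF prime odd primroot M] by (metis cong_sym cong_trans)
qed

lemma minus_one_mod_4: "(4 * p - 1) mod 4 = 3"
proof -
  have "4 * p - 1 = 3 + 4 * (p - 1)" using p_eq by simp
  then show ?thesis by (simp only: mod_mult_self2) simp
qed

text \<open>Modulo \<open>p\<close> the generators are \<open>r ^ i\<close> and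
  \<open>r ^ M\<close>, so they generate the cyclic group of \<open>r ^ gcd i M\<close> inside a
  cyclic group of order \<open>2 * M\<close>.\<close>

lemma orb_size_p:
  assumes u: "[u = r ^ i] (mod p)"
  shows "card ((\<lambda>v. v mod p) ` neg_span (4 * p) u) = 2 * M div gcd i M"
proof -
  define \<beta> where "\<beta> = gcd i M"
  have val: "[u ^ a * (4 * p - 1) ^ b = r ^ (i * a + M * b)] (mod p)" for a b
    unfolding power_add power_mult by (intro cong_mult cong_pow u minus_one_cong)
  have "(\<lambda>v. v mod p) ` neg_span (4 * p) u = range (\<lambda>k. (r ^ \<beta>) ^ k mod p)"
  proof (intro equalityI subsetI)
    fix y assume "y \<in> (\<lambda>v. v mod p) ` neg_span (4 * p) u"
    then obtain a b where y: "y = (u ^ a * (4 * p - 1) ^ b) mod p" by (auto simp: neg_span_def)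
    have "\<beta> dvd i * a + M * b" by (simp add: \<beta>_def)
    then obtain k where "i * a + M * b = \<beta> * k" by (rule dvdE)
    then have "y = (r ^ \<beta>) ^ k mod p" using val[of a b] unfolding y cong_def by (simp only: power_mult)
    then show "y \<in> range (\<lambda>k. (r ^ \<beta>) ^ k mod p)" by (rule range_eqI)
  next
    fix y assume "y \<in> range (\<lambda>k. (r ^ \<beta>) ^ k mod p)"
    then obtain k where y: "y = (r ^ \<beta>) ^ k mod p" by blast
    \<comment> \<open>The natural-number Bezout identity gives
      \<open>i * s = M * t + \<beta>\<close>. Adding \<open>M * t\<close> to both sides replaces the
      subtraction by \<open>2 * M * t\<close>, a multiple of the order of \<open>r\<close>. For
      \<open>i = 0\<close> the gcd is \<open>M\<close> itself.\<close>
    obtain s t z where st: "i * s + M * t = 2 * M * z + \<beta>"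
    proof (cases "i = 0")
      case True
      then show ?thesis using that[of 0 1 0] by (simp add: \<beta>_def)
    next
      case False
      then obtain s t where "i * s = M * t + \<beta>" using bezout_nat[of i M] unfolding \<beta>_def by blast
      then show ?thesis using that[of s t t] by simp
    qed
    have "[r ^ (i * s + M * t) = r ^ \<beta>] (mod p)"
      unfolding order_divides_expdiff[OF coprime_p_r] ord_r st by (simp add: cong_def)
    then have "[(r ^ (i * s + M * t)) ^ k = (r ^ \<beta>) ^ k] (mod p)" by (rule cong_pow)
    moreover have "(r ^ (i * s + M * t)) ^ k = r ^ (i * (s * k) + M * (t * k))"
      by (simp add: power_mult[symmetric] algebra_simps)
    ultimately have "[u ^ (s * k) * (4 * p - 1) ^ (t * k) = (r ^ \<beta>) ^ k] (mod p)"
      using val[of "s * k" "t * k"] by (metis cong_trans)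
    then have "y = (u ^ (s * k) * (4 * p - 1) ^ (t * k)) mod p" by (simp only: y cong_def)
    then show "y \<in> (\<lambda>v. v mod p) ` neg_span (4 * p) u" unfolding neg_span_def by blast
  qed
  moreover have "coprime p (r ^ \<beta>)" using coprime_p_r by simp
  moreover have "ord p (r ^ \<beta>) = 2 * M div gcd i M"
  proof -
    have "gcd \<beta> (2 * M) = \<beta>" by (simp add: \<beta>_def gcd_nat.absorb1)
    then show ?thesis using ord_power[OF coprime_p_r, of \<beta>] by (simp only: ord_r \<beta>_def)
  qed
  ultimately show ?thesis using card_range_power_mod by simp
qed

context
  fixes u assumes u: "coprime u (4 * p)"
begin

lemma neg_span_coprime: "v \<in> neg_span (4 * p) u \<Longrightarrow> coprime v (4 * p)"
  using unit_submonoid.coprime[OF unit_submonoid_neg_span[OF _ u]] p_eq by simp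

lemma neg_span_odd: "v \<in> neg_span (4 * p) u \<Longrightarrow> odd v"
proof
  assume "v \<in> neg_span (4 * p) u" "2 dvd v"
  then show False using coprime_common_divisor_nat[OF neg_span_coprime, of v 2] by simp
qed

lemma one_in_neg_span: "1 \<in> neg_span (4 * p) u"
  using unit_submonoid.one_closed[OF unit_submonoid_neg_span[OF _ u]] p_eq by simp

lemma minus_one_in_neg_span: "4 * p - 1 \<in> neg_span (4 * p) u"
proof -
  have "u ^ 0 * (4 * p - 1) ^ 1 \<in> neg_span (4 * p) u" unfolding neg_span_def by blast
  then show ?thesis by simp
qed

lemma orb_size_2: "card ((\<lambda>v. v mod 2) ` neg_span (4 * p) u) = 1"
proof -
  have "(\<lambda>v. v mod 2) ` neg_span (4 * p) u = {1}"
    using neg_span_odd one_in_neg_span by (auto simp: odd_iff_mod_2_eq_one intro!: image_eqI[of _ _ 1])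
  then show ?thesis by simp
qed

lemma orb_size_4: "card ((\<lambda>v. v mod 4) ` neg_span (4 * p) u) = 2"
proof -
  have "v mod 4 = 1 \<or> v mod 4 = 3" if "v \<in> neg_span (4 * p) u" for v
    using neg_span_odd[OF that] by presburger
  then have "(\<lambda>v. v mod 4) ` neg_span (4 * p) u = {1, 3}"
    using imageI[OF one_in_neg_span, of "\<lambda>v. v mod 4"] imageI[OF minus_one_in_neg_span, of "\<lambda>v. v mod 4"]
      minus_one_mod_4 by auto
  then show ?thesis by simp
qed

text \<open>All members of the monoid are odd, so by the Chinese remainder theorem their residues
  modulo \<open>p\<close> determine those modulo \<open>2 * p\<close>.\<close>

lemma orb_size_2p:
  "card ((\<lambda>v. v mod (2 * p)) ` neg_span (4 * p) u) = card ((\<lambda>v. v mod p) ` neg_span (4 * p) u)"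
proof -
  have "inj_on (\<lambda>y. y mod p) ((\<lambda>v. v mod (2 * p)) ` neg_span (4 * p) u)"
  proof (rule inj_onI)
    fix y z
    assume yz: "y \<in> (\<lambda>v. v mod (2 * p)) ` neg_span (4 * p) u" "z \<in> (\<lambda>v. v mod (2 * p)) ` neg_span (4 * p) u"
      and eq: "y mod p = z mod p"
    obtain v w where vw: "v \<in> neg_span (4 * p) u" "w \<in> neg_span (4 * p) u"
      "y = v mod (2 * p)" "z = w mod (2 * p)" using yz by blast
    have "[v = w] (mod 2)" using vw neg_span_odd by (simp add: cong_def odd_iff_mod_2_eq_one)
    moreover have "[v = w] (mod p)" using eq vw by (simp add: cong_def mod_mod_cancel)
    ultimately have "[v = w] (mod 2 * p)"
      using odd by (intro coprime_cong_mult_nat) (simp_all add: coprime_left_2_iff_odd)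
    then show "y = z" using vw by (simp add: cong_def)
  qed
  moreover have "(\<lambda>y. y mod p) ` ((\<lambda>v. v mod (2 * p)) ` neg_span (4 * p) u) = (\<lambda>v. v mod p) ` neg_span (4 * p) u"
    by (simp add: image_image mod_mod_cancel)
  ultimately show ?thesis by (metis card_image)
qed

end

text \<open>Powers of \<open>u\<close> are 1 modulo 4 and their negatives are 3, so adjoining -1
  doubles the group generated by \<open>u\<close>.\<close>

lemma orb_size_4p:
  assumes u: "[u = 1] (mod 4)" "[u = r ^ i] (mod p)"
  shows "card ((\<lambda>v. v mod (4 * p)) ` neg_span (4 * p) u) = 2 * (2 * M div gcd i (2 * M))"
proof -
  define n where "n = 4 * p"
  have n: "n > 0" using p_eq by (simp add: n_def)
  define A where "A = range (\<lambda>k. u ^ k mod n)"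
  define neg where "neg = (\<lambda>y. (n - 1) * y mod n)"
  have u4: "u ^ k mod 4 = 1" for k
    using cong_pow[OF u(1), of k] by (simp add: cong_def)
  have n4: "(n - 1) mod 4 = 3" unfolding n_def by (rule minus_one_mod_4)
  have A4: "y mod 4 = 1" if "y \<in> A" for y
    using that u4 by (auto simp: A_def n_def mod_mod_cancel)
  have neg4: "neg y mod 4 = 3" if "y \<in> A" for y
  proof -
    have "neg y mod 4 = ((n - 1) mod 4) * (y mod 4) mod 4"
      by (simp add: neg_def n_def mod_mod_cancel mod_mult_eq)
    then show ?thesis unfolding n4 A4[OF that] by simp
  qed
  have cop_u: "coprime u n"
  proof -
    have "coprime u 4" using u(1) by (metis cong_imp_coprime cong_sym coprime_1_left)
    moreover have "coprime u p" using u(2) by (rule coprime_p_if_cong_power)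
    ultimately show ?thesis by (simp only: n_def coprime_mult_right_iff)
  qed
  have "(\<lambda>v. v mod n) ` neg_span n u = A \<union> neg ` A"
    unfolding A_def neg_def using n by (rule neg_span_mod)
  moreover have "A \<inter> neg ` A = {}"
  proof -
    have "y \<noteq> neg z" if "y \<in> A" "z \<in> A" for y z
      using A4[OF that(1)] neg4[OF that(2)] by auto
    then show ?thesis by blast
  qed
  moreover have "A \<subseteq> {0..<n}" using n by (auto simp: A_def)
  moreover have "card (neg ` A) = card A"
    unfolding neg_def
    by (intro card_image inj_on_subset[OF inj_on_mult_mod[OF coprime_diff_one_left_nat[OF n]]] \<open>A \<subseteq> {0..<n}\<close>)
  ultimately have "card ((\<lambda>v. v mod n) ` neg_span n u) = 2 * card A"
    using finite_subset[of A "{0..<n}"] by (simp add: card_Un_disjoint)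
  also have "card A = ord n u"
    unfolding A_def using cop_u by (intro card_range_power_mod) (simp add: coprime_commute)
  \<comment> \<open>Powers of \<open>u\<close> are always 1 modulo 4, so only the congruence modulo
    \<open>p\<close> decides when one equals 1.\<close>
  also have "ord n u = ord p u"
  proof (rule dvd_antisym)
    have "[u ^ ord p u = 1] (mod 4 * p)"
      by (intro coprime_cong_mult_nat coprime_4_p ord) (simp add: cong_def u4)
    then show "ord n u dvd ord p u" by (simp only: n_def ord_divides)
    have "[u ^ ord n u = 1] (mod p)"
      using ord[of u n] by (rule cong_dvd_modulus_nat) (simp add: n_def)
    then show "ord p u dvd ord n u" by (simp only: ord_divides)
  qed
  also have "ord p u = ord p (r ^ i)" using u(2) by (rule ord_cong)
  also have "\<dots> = 2 * M div gcd i (2 * M)" using ord_power[OF coprime_p_r, of i] by (simp only: ord_r)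
  finally show ?thesis by (simp only: n_def)
qed

text \<open>The factor \<open>P\<close> joins the equal contributions of the orders \<open>p\<close>
  and \<open>2 * p\<close>; orders 2 and 4 give \<open>1 + x\<close> and \<open>1 + x ^ 2\<close>,
  and order \<open>4 * p\<close> gives the leading factor. The four summands are the terms of the
  inclusion-exclusion.\<close>

lemma sum_fixed_one_mod_4:
  fixes x :: real
  assumes u: "[u = 1] (mod 4)" "[u = r ^ i] (mod p)"
  defines "P \<equiv> (1 + x ^ (2 * M div gcd i M)) ^ (2 * gcd i M)"
  shows "(\<Sum>\<Omega> | \<Omega> \<in> Gset (4 * p) \<and> dilate (4 * p) u \<Omega> = \<Omega>. x ^ card \<Omega>) =
    (1 + x ^ (4 * M div gcd i (2 * M))) ^ gcd i (2 * M) * P * (1 + x ^ 2) * (1 + x)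
    - P * (1 + x) - (1 + x ^ 2) * (1 + x) + (1 + x)"
proof -
  have n: "4 * p > 0" using p_eq by simp
  have cop: "coprime u (4 * p)"
  proof -
    have "coprime u 4" using u(1) by (metis cong_imp_coprime cong_sym coprime_1_left)
    moreover have "coprime u p" using u(2) by (rule coprime_p_if_cong_power)
    ultimately show ?thesis by (simp only: coprime_mult_right_iff)
  qed
  interpret unit_submonoid "4 * p" "neg_span (4 * p) u" using unit_submonoid_neg_span[OF n cop] .
  define R where "R = (\<lambda>m. (1 + x ^ orb_size m) ^ (totient m div orb_size m))"
  have p2: "p > 2" using p_eq M_pos by simp
  have tot_p: "totient p = 2 * M" using prime M by (simp add: totient_prime)
  have tot_2p: "totient (2 * p) = 2 * M" using odd tot_p by (simp add: totient_double)
  have tot_4p: "totient (4 * p) = 4 * M"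
    using totient_double[of "2 * p"] tot_2p by simp
  have R_2: "R 2 = 1 + x" by (simp add: R_def orb_size_def orb_size_2[OF cop])
  have R_4: "R 4 = 1 + x ^ 2" by (simp add: R_def orb_size_def orb_size_4[OF cop])
  have quot: "N div (N div g) = g" if "g dvd N" "N > 0" for g N :: nat
    using that by (metis div_div_eq_right dvd_refl div_self mult_1 less_not_refl)
  have s_p: "orb_size p = 2 * M div gcd i M" by (simp only: orb_size_def orb_size_p[OF u(2)])
  have s_2p: "orb_size (2 * p) = 2 * M div gcd i M"
    by (simp only: orb_size_def orb_size_2p[OF cop] orb_size_p[OF u(2)])
  have "4 * M div gcd i (2 * M) = 2 * (2 * M div gcd i (2 * M))"
    using div_mult_swap[of "gcd i (2 * M)" "2 * M" 2] by simp
  then have s_4p: "orb_size (4 * p) = 4 * M div gcd i (2 * M)"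
    by (simp only: orb_size_def orb_size_4p[OF u])
  have "gcd i M dvd 2 * M" by simp
  then have R_p: "R p = (1 + x ^ (2 * M div gcd i M)) ^ gcd i M"
    and R_2p: "R (2 * p) = (1 + x ^ (2 * M div gcd i M)) ^ gcd i M"
    using M_pos by (simp_all only: R_def s_p s_2p tot_p tot_2p quot)
  have "gcd i (2 * M) dvd 4 * M" by (rule dvd_trans[of _ "2 * M"]) simp_all
  then have R_4p: "R (4 * p) = (1 + x ^ (4 * M div gcd i (2 * M))) ^ gcd i (2 * M)"
    using M_pos quot[of "gcd i (2 * M)" "4 * M"] by (simp only: R_def s_4p tot_4p)
  have P: "P = R p * R (2 * p)"
    unfolding P_def R_p R_2p by (simp only: mult_2 power_add)
  have D_2: "{m. m dvd 2 \<and> m \<noteq> 1} = {2 :: nat}"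
    using two_is_prime_nat by (auto simp: prime_nat_iff)
  have D_2p: "{m. m dvd 2 * p \<and> m \<noteq> 1} = {p, 2, 2 * p}"
    unfolding divisors_mult_prime[OF prime] D_2 by auto
  have D_4p: "{m. m dvd 4 * p \<and> m \<noteq> 1} = {p, 2, 4, 2 * p, 4 * p}"
    unfolding divisors_mult_prime[OF prime] divisors_4 by auto
  \<comment> \<open>Together with \<open>p > 2\<close> this makes the listed divisors distinct, so
    that the product over them splits into single factors.\<close>
  have p4: "p \<noteq> 4" using odd by auto
  have W: "(\<Sum>\<Omega> | \<Omega> \<subseteq> {y\<in>{1..<4 * p}. 4 * p div gcd y (4 * p) dvd e} \<and> invariant \<Omega>. x ^ card \<Omega>)
      = (\<Prod>m | m dvd e \<and> m \<noteq> 1. R m)" if "e dvd 4 * p" for e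
    unfolding R_def by (rule sum_invariant_order_dvd[OF that])
  have dvds: "4 * p dvd 4 * p" "2 * p dvd 4 * p" "4 dvd 4 * p" "2 dvd 4 * p"
    by (simp_all add: mult_dvd_mono)
  have "(\<Sum>\<Omega> | \<Omega> \<in> Gset (4 * p) \<and> dilate (4 * p) u \<Omega> = \<Omega>. x ^ card \<Omega>) =
      R p * (R 2 * (R 4 * (R (2 * p) * R (4 * p)))) - R p * (R 2 * R (2 * p)) - R 2 * R 4 + R 2"
    unfolding sum_fixed_Gset[OF prime odd cop] dvds[THEN W] D_4p D_2p D_2 divisors_4
    using p2 p4 by simp
  then show ?thesis unfolding P R_2 R_4 R_4p by (simp only: mult_ac)
qed

section \<open>Discrete logarithms and summation over the units\<close>

definition dlog :: "nat \<Rightarrow> nat" where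
  "dlog u = (SOME i. i < 2 * M \<and> [u = r ^ i] (mod p))"

lemma generator: "bij_betw (\<lambda>i. r ^ i mod p) {..<2 * M} (totatives p)"
  using residue_primroot_is_generator[OF prime_gt_1_nat[OF prime] primroot] prime M
  by (simp add: totient_prime)

lemma dlog:
  assumes "coprime u p"
  shows "dlog u < 2 * M" "[u = r ^ dlog u] (mod p)"
proof -
  have "u mod p \<noteq> 0" using assms prime by (metis coprime_absorb_right mod_0_imp_dvd not_prime_unit)
  then have "u mod p \<in> totatives p"
    using assms prime_gt_0_nat[OF prime] by (simp add: totatives_def)
  then obtain i where "i < 2 * M" "u mod p = r ^ i mod p"
    using generator unfolding bij_betw_def by blast
  then have "\<exists>i. i < 2 * M \<and> [u = r ^ i] (mod p)" by (auto simp: cong_def)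
  then have "dlog u < 2 * M \<and> [u = r ^ dlog u] (mod p)" unfolding dlog_def by (rule someI_ex)
  then show "dlog u < 2 * M" "[u = r ^ dlog u] (mod p)" by auto
qed

text \<open>By the Chinese remainder theorem, a unit modulo \<open>4 * p\<close> with prescribed
  residue \<open>c\<close> modulo 4 is the same as a unit modulo \<open>p\<close>, hence as an
  exponent of \<open>r\<close>.\<close>

lemma bij_betw_dlog:
  assumes c: "coprime c 4" "c < 4"
  shows "bij_betw dlog {u \<in> zunits (4 * p). u mod 4 = c} {..<2 * M}"
  unfolding bij_betw_def
proof (intro conjI inj_onI equalityI subsetI)
  fix u v assume u: "u \<in> {u \<in> zunits (4 * p). u mod 4 = c}" and v: "v \<in> {u \<in> zunits (4 * p). u mod 4 = c}"
    and eq: "dlog u = dlog v"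
  have "coprime u p" "coprime v p" using u v by (simp_all add: zunits_iff)
  then have "[u = v] (mod p)" using dlog(2)[of u] dlog(2)[of v] unfolding eq by (metis cong_sym cong_trans)
  moreover have "[u = v] (mod 4)" using u v by (simp add: cong_def)
  ultimately have "[u = v] (mod 4 * p)" using coprime_4_p by (intro coprime_cong_mult_nat)
  then show "u = v" using u v by (auto simp: zunits_iff cong_def)
next
  fix i assume "i \<in> dlog ` {u \<in> zunits (4 * p). u mod 4 = c}"
  then show "i \<in> {..<2 * M}" using dlog(1) by (auto simp: zunits_iff)
next
  fix i assume i: "i \<in> {..<2 * M}"
  obtain v where v: "[v = c] (mod 4)" "[v = r ^ i] (mod p)"
    using binary_chinese_remainder_nat[OF coprime_4_p] by blast
  define u where "u = v mod (4 * p)"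
  have u: "[u = c] (mod 4)" "[u = r ^ i] (mod p)"
    using v by (simp_all add: u_def cong_def mod_mod_cancel)
  have "coprime u 4" using u(1) c(1) by (metis cong_imp_coprime cong_sym)
  moreover have cop: "coprime u p" using u(2) by (rule coprime_p_if_cong_power)
  moreover have "u < 4 * p" using p_eq by (simp add: u_def)
  ultimately have "u \<in> zunits (4 * p)" by (simp only: zunits_iff coprime_mult_right_iff)
  moreover have "u mod 4 = c" using u(1) c(2) by (simp add: cong_def)
  moreover have "dlog u = i"
  proof -
    have "r ^ dlog u mod p = r ^ i mod p" using dlog(2)[OF cop] u(2) by (simp add: cong_def)
    moreover have "inj_on (\<lambda>i. r ^ i mod p) {..<2 * M}" using generator by (rule bij_betw_imp_inj_on)
    ultimately show ?thesis using i dlog(1)[OF cop] by (auto dest: inj_onD)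
  qed
  ultimately show "i \<in> dlog ` {u \<in> zunits (4 * p). u mod 4 = c}" by blast
qed

text \<open>On symmetric sets \<open>u\<close> and \<open>- u\<close> act alike. Passing to
  \<open>- u\<close> moves to the class of 1 modulo 4 and adds \<open>M\<close>, the logarithm of
  -1.\<close>

lemma sum_fixed_three_mod_4:
  fixes x :: real
  assumes u: "[u = 3] (mod 4)" "[u = r ^ i] (mod p)"
  shows "(\<Sum>\<Omega> | \<Omega> \<in> Gset (4 * p) \<and> dilate (4 * p) u \<Omega> = \<Omega>. x ^ card \<Omega>) =
    (\<Sum>\<Omega> | \<Omega> \<in> Gset (4 * p) \<and> dilate (4 * p) (u * (4 * p - 1)) \<Omega> = \<Omega>. x ^ card \<Omega>)"
    and "[u * (4 * p - 1) = 1] (mod 4)" "[u * (4 * p - 1) = r ^ (i + M)] (mod p)"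
proof -
  have "4 * p > 0" using p_eq by simp
  then have "dilate (4 * p) (4 * p - 1) \<Omega> = \<Omega>" if "\<Omega> \<in> Gset (4 * p)" for \<Omega>
    using that Gset_iff by blast
  then have "{\<Omega>. \<Omega> \<in> Gset (4 * p) \<and> dilate (4 * p) u \<Omega> = \<Omega>} =
      {\<Omega>. \<Omega> \<in> Gset (4 * p) \<and> dilate (4 * p) (u * (4 * p - 1)) \<Omega> = \<Omega>}"
    using dilate_neg_fixed by auto
  then show "(\<Sum>\<Omega> | \<Omega> \<in> Gset (4 * p) \<and> dilate (4 * p) u \<Omega> = \<Omega>. x ^ card \<Omega>) =
    (\<Sum>\<Omega> | \<Omega> \<in> Gset (4 * p) \<and> dilate (4 * p) (u * (4 * p - 1)) \<Omega> = \<Omega>. x ^ card \<Omega>)" by simp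
  have "[4 * p - 1 = 3] (mod 4)" using minus_one_mod_4 by (simp add: cong_def)
  with u(1) have "[u * (4 * p - 1) = 3 * 3] (mod 4)" by (rule cong_mult)
  then show "[u * (4 * p - 1) = 1] (mod 4)" by (simp add: cong_def)
  show "[u * (4 * p - 1) = r ^ (i + M)] (mod p)"
    unfolding power_add by (intro cong_mult u minus_one_cong)
qed

lemma Psi_w_4p:
  fixes x :: real
  defines "P \<equiv> \<lambda>d. (1 + x ^ (2 * M div gcd d M)) ^ (2 * gcd d M)"
    and "Q \<equiv> \<lambda>d. (1 + x ^ (4 * M div d)) ^ d"
  shows "real (4 * M) * Psi_w (4 * p) x = (\<Sum>d | d dvd 2 * M. real (totient (2 * M div d)) *
    ((Q d + Q (gcd (M + d) (2 * M))) * P d * (1 + x ^ 2) * (1 + x)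
     - 2 * P d * (1 + x) - 2 * (1 + x ^ 2) * (1 + x) + 2 * (1 + x)))"
proof -
  define F where "F = (\<lambda>u. \<Sum>\<Omega> | \<Omega> \<in> Gset (4 * p) \<and> dilate (4 * p) u \<Omega> = \<Omega>. x ^ card \<Omega>)"
  define T where "T = (\<lambda>i. Q (gcd i (2 * M)) * P i * (1 + x ^ 2) * (1 + x)
    - P i * (1 + x) - (1 + x ^ 2) * (1 + x) + (1 + x))"
  define U where "U = (\<lambda>c. {u \<in> zunits (4 * p). u mod 4 = c})"
  have F: "F u = T i" if "[u = 1] (mod 4)" "[u = r ^ i] (mod p)" for u i
    unfolding F_def T_def P_def Q_def using that by (rule sum_fixed_one_mod_4)
  have cop: "coprime u p" if "u \<in> U c" for u c using that by (simp add: U_def zunits_iff)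
  have "sum F (U 1) = (\<Sum>u\<in>U 1. T (dlog u))"
  proof (intro sum.cong refl)
    fix u assume u: "u \<in> U 1"
    then have "[u = 1] (mod 4)" by (simp add: U_def cong_def)
    then show "F u = T (dlog u)" using dlog(2)[OF cop[OF u]] by (rule F)
  qed
  also have "\<dots> = (\<Sum>j<2 * M. T j)"
    unfolding U_def by (intro sum.reindex_bij_betw bij_betw_dlog) simp_all
  finally have U1: "sum F (U 1) = (\<Sum>j<2 * M. T j)" .
  have "sum F (U 3) = (\<Sum>u\<in>U 3. T (dlog u + M))"
  proof (intro sum.cong refl)
    fix u assume u: "u \<in> U 3"
    then have u4: "[u = 3] (mod 4)" by (simp add: U_def cong_def)
    note * = sum_fixed_three_mod_4[OF u4 dlog(2)[OF cop[OF u]]]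
    show "F u = T (dlog u + M)" using F[OF *(2,3)] *(1)[of x] unfolding F_def by simp
  qed
  also have "\<dots> = (\<Sum>j<2 * M. T (j + M))"
    unfolding U_def
    by (intro sum.reindex_bij_betw[of dlog _ _ "\<lambda>j. T (j + M)"] bij_betw_dlog)
      (simp_all add: coprime_iff_gcd_eq_1 gcd_non_0_nat)
  finally have U3: "sum F (U 3) = (\<Sum>j<2 * M. T (j + M))" .
  have "zunits (4 * p) = U 1 \<union> U 3"
  proof -
    have "u mod 4 = 1 \<or> u mod 4 = 3" if "u \<in> zunits (4 * p)" for u
    proof -
      have "odd u" using that coprime_common_divisor_nat[of u "4 * p" 2] by (auto simp: zunits_iff)
      then show ?thesis by presburger
    qed
    then show ?thesis by (auto simp: U_def)
  qed
  moreover have "U 1 \<inter> U 3 = {}" by (auto simp: U_def)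
  moreover have "finite (U c)" for c by (simp add: U_def zunits_def)
  ultimately have "sum F (zunits (4 * p)) = (\<Sum>j<2 * M. T j) + (\<Sum>j<2 * M. T (j + M))"
    using U1 U3 by (simp add: sum.union_disjoint)
  moreover have "totient (4 * p) = 4 * M"
    using totient_double[of "2 * p"] totient_double[of p] odd prime M by (simp add: totient_prime)
  moreover have "1 < 4 * p" using p_eq by simp
  ultimately have "real (4 * M) * Psi_w (4 * p) x = (\<Sum>j<2 * M. T j + T (j + M))"
    using Psi_w_burnside[of "4 * p" x] by (simp add: F_def sum.distrib)
  also have "\<dots> = (\<Sum>j<2 * M. (\<lambda>d. (Q d + Q (gcd (M + d) (2 * M))) * P d * (1 + x ^ 2) * (1 + x)
     - 2 * P d * (1 + x) - 2 * (1 + x ^ 2) * (1 + x) + 2 * (1 + x)) (gcd j (2 * M)))"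
  proof (intro sum.cong refl)
    fix j
    \<comment> \<open>\<open>P\<close> sees its argument only through the gcd with \<open>M\<close>,
      so neither the shift by \<open>M\<close> nor the passage to \<open>gcd j (2 * M)\<close>
      alters it; only \<open>Q\<close> feels the shift, through \<open>gcd_add_half\<close>.\<close>
    have "gcd (gcd j (2 * M)) M = gcd j M" by (simp add: gcd.assoc)
    then have "P (gcd j (2 * M)) = P j" by (simp only: P_def)
    moreover have "P (j + M) = P j" by (simp only: P_def gcd_add1)
    ultimately show "T j + T (j + M) =
      (\<lambda>d. (Q d + Q (gcd (M + d) (2 * M))) * P d * (1 + x ^ 2) * (1 + x)
     - 2 * P d * (1 + x) - 2 * (1 + x ^ 2) * (1 + x) + 2 * (1 + x)) (gcd j (2 * M))"
      unfolding T_def gcd_add_half[OF M_pos] by (simp only: algebra_simps)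
  qed
  also have "\<dots> = (\<Sum>d | d dvd 2 * M. real (totient (2 * M div d)) *
    ((Q d + Q (gcd (M + d) (2 * M))) * P d * (1 + x ^ 2) * (1 + x)
     - 2 * P d * (1 + x) - 2 * (1 + x ^ 2) * (1 + x) + 2 * (1 + x)))"
    by (rule sum_gcd_eq_sum_dvd) (use M_pos in simp)
  finally show ?thesis .
qed

end

section \<open>The enumerator for \<open>4 * p\<close> and its value at 1\<close>

theorem theorem4p5:
  fixes p :: nat
  assumes "prime p" and "odd p"
  shows "(\<forall>x::real. Psi_w (4 * p) x =
     1 / (2 * real p - 2) *
     (\<Sum>d \<in> {d. d dvd p - 1}.
        real (totient ((p - 1) div d)) *
        (((1 + x ^ ((2 * p - 2) div d)) ^ d
           + (1 + x ^ ((2 * p - 2) div gcd ((p - 1) div 2 + d) (p - 1))) ^ gcd ((p - 1) div 2 + d) (p - 1))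
          * (1 + x ^ ((p - 1) div gcd d ((p - 1) div 2))) ^ (2 * gcd d ((p - 1) div 2))
          * (1 + x ^ 2) * (1 + x)
         - 2 * (1 + x ^ ((p - 1) div gcd d ((p - 1) div 2))) ^ (2 * gcd d ((p - 1) div 2)) * (1 + x)
         - 2 * (1 + x ^ 2) * (1 + x)
         + 2 * (1 + x))))
   \<and> E_w (4 * p) =
     1 / (2 * real p - 2) *
     (\<Sum>d \<in> {d. d dvd p - 1}.
        real (totient ((p - 1) div d)) *
        (4 ^ (gcd d ((p - 1) div 2) + 1) * (2 ^ d + 2 ^ gcd ((p - 1) div 2 + d) (p - 1))
         - 2 ^ (2 * gcd d ((p - 1) div 2) + 2) - 4))"
  (is "(\<forall>x. _ = ?c * ?S x) \<and> _ = ?c * ?T")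
proof -
  obtain r where r: "residue_primroot p r"
    using prime_primitive_root_exists[of p] assms(1) prime_gt_1_nat by blast
  define M where "M = (p - 1) div 2"
  have M2: "p - 1 = 2 * M" using assms(2) by (auto simp: M_def elim: oddE)
  interpret odd_prime_primroot p r M using assms r M2 by unfold_locales
  have eqs: "p - 1 = 2 * M" "2 * p - 2 = 4 * M" "2 * M div 2 = M" using p_eq by simp_all
  have solve: "b = 1 / a * s" if "a * b = s" "a \<noteq> 0" for a b s :: real
    using that by (simp add: field_simps)
  have real_M: "real (4 * M) = 2 * real p - 2" using p_eq by simp
  have Psi: "Psi_w (4 * p) x = ?c * ?S x" for x
  proof (rule solve)
    show "(2 * real p - 2) * Psi_w (4 * p) x = ?S x"
      using Psi_w_4p[of x] unfolding real_M eqs .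
    show "2 * real p - 2 \<noteq> 0" using real_M M_pos by simp
  qed
  have "?S 1 = ?T"
  proof (intro sum.cong refl arg_cong2[where f = "(*)"])
    fix d
    \<comment> \<open>At 1 every binomial equals 2, so \<open>(1 + x ^ 2) * (1 + x)\<close> supplies
      the extra factor 4 in the power of 4, and the constants combine to -8 + 4.\<close>
    have "(4 :: real) ^ (gcd d ((p - 1) div 2) + 1) = 2 ^ (2 * gcd d ((p - 1) div 2)) * 4"
      by (simp add: power_mult)
    then show "((1 + 1 ^ ((2 * p - 2) div d)) ^ d
           + (1 + 1 ^ ((2 * p - 2) div gcd ((p - 1) div 2 + d) (p - 1))) ^ gcd ((p - 1) div 2 + d) (p - 1))
          * (1 + 1 ^ ((p - 1) div gcd d ((p - 1) div 2))) ^ (2 * gcd d ((p - 1) div 2))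
          * (1 + 1 ^ 2) * (1 + 1)
         - 2 * (1 + 1 ^ ((p - 1) div gcd d ((p - 1) div 2))) ^ (2 * gcd d ((p - 1) div 2)) * (1 + 1)
         - 2 * (1 + 1 ^ 2) * (1 + 1) + 2 * (1 + 1) =
        4 ^ (gcd d ((p - 1) div 2) + 1) * (2 ^ d + 2 ^ gcd ((p - 1) div 2 + d) (p - 1))
         - 2 ^ (2 * gcd d ((p - 1) div 2) + 2) - (4 :: real)"
      by (simp only: power_one one_add_one power_add) simp
  qed
  then have "E_w (4 * p) = ?c * ?T" using Psi[of 1] by (simp only: E_w_def)
  then show ?thesis using Psi by blast
qed

end
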